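(* The following functions are strongly realizable ($0\le x<1$): \[ \log(1+x),\qquad \arctan(x),\qquad \frac12\arcsin(x),\qquad \int_0^x e^{-w^2/2}\,dw. \] The first two only require one bag; the third requires a bag and a stack; the fourth can be implemented with a string register and a bag.
   Context: A Buffon machine is a deterministic device belonging to a computationally universal class (Turing machines or, equivalently, register machines), equipped with an external source of independent uniform random bits (each call to this source is a ``flip'') and with input--output queues capable of storing integers, and which is assumed to halt with probability $1$. A function $\lambda\mapsto\phi(\lambda)$ is weakly realizable if there is a machine $\mathcal M$ (one machine for all $\lambda$ in the stated range) which, when provided on its input with a perfect generator of independent Bernoulli variables of unknown parameter $\lambda$ (a source of independent $\{0,1\}$-values, each equal to $1$ with probability $\lambda$), outputs, with probability $1$, a Bernoulli random variable of parameter $\phi(\lambda)$. It is strongly realizable if moreover the random number $C\equiv C(\lambda)$ of coin flips has exponential tails, i.e., there are constants $K$ and $\rho<1$ such that $\Pr(C>m)\le K\rho^m$ for all $m$. Resources, in addition to finite control: a (geometric) bag is a lazily evaluated vector $U=(\upsilon_1,\upsilon_2,\dots)$ of bits, all initially unassigned, representing the binary expansion of a uniform random $U\in[0,1]$; a call to the bag draws, by means of flips, an index $J=1+G$ with $G$ a fresh geometric variable, $\Pr(G=r)=2^{-r-1}$, $r\ge0$, assigns to $\upsilon_J$ the result of a flip if $\upsilon_J$ is unassigned, and returns $\upsilon_J$. A stack is a pushdown store (here, of unary symbols). A string register is a register storing a finite string of bits (such as a partial binary expansion of a random real number). *)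

theory Defs
  imports "HOL-Probability.Probability"
begin

text \<open>
  A machine is a finite program, a list of instructions addressed by position, acting on integer
  registers, stacks, string registers and geometric bags. Machines with integer registers alone are
  Minsky machines with coin flips, hence computationally universal; a bag call and the string and
  stack instructions can be compiled into them, and are kept primitive so that the resources which
  a program needs can be read off its text. Instructions carry the addresses of their successors. A
  two-way random or string branch lists the successor for bit 0 before the one for bit 1.
\<close>

type_synonym label = nat

datatype side = Front | Back

datatype instr =
    Flip label label
  | Input label label
  | Emit nat label
  | EmitRegister nat label
  | Incr nat label
  | Decr nat label label
  | Push nat label
  | Pop nat label label
  | Insert side nat bool label
  | Remove side nat label label label
  | CallBag nat label label

type_synonym machine = "instr list"

datatype resource = Register nat | Stack nat | StringRegister nat | Bag nat

fun resources :: "instr \<Rightarrow> resource set" where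
  "resources (Flip l0 l1) = {}"
| "resources (Input l0 l1) = {}"
| "resources (Emit n l) = {}"
| "resources (EmitRegister r l) = {Register r}"
| "resources (Incr r l) = {Register r}"
| "resources (Decr r lz l) = {Register r}"
| "resources (Push s l) = {Stack s}"
| "resources (Pop s le l) = {Stack s}"
| "resources (Insert d t b l) = {StringRegister t}"
| "resources (Remove d t le l0 l1) = {StringRegister t}"
| "resources (CallBag k l0 l1) = {Bag k}"

definition uses :: "machine \<Rightarrow> resource set" where
  "uses M = (\<Union>i\<in>set M. resources i)"

text \<open>
  The stack alphabet is unary, so \<^typ>\<open>unit\<close>. In a bag, index \<open>j \<ge> 1\<close> holds the bit \<open>\<upsilon>\<^sub>j\<close>, and
  \<^term>\<open>None\<close> means unassigned. The field \<open>flips\<close> is not accessible to the program: it records the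
  cost, i.e. the number of uniform random bits drawn so far. The integers in \<open>out_queue\<close> are listed in
  the order in which they were emitted.
\<close>

record config =
  pc :: label
  registers :: "nat \<Rightarrow> nat"
  stacks :: "nat \<Rightarrow> unit list"
  strings :: "nat \<Rightarrow> bool list"
  bags :: "nat \<Rightarrow> nat \<Rightarrow> bool option"
  out_queue :: "nat list"
  flips :: nat

definition initial :: config where
  "initial = \<lparr>pc = 0, registers = (\<lambda>_. 0), stacks = (\<lambda>_. []), strings = (\<lambda>_. []),
              bags = (\<lambda>_ _. None), out_queue = [], flips = 0\<rparr>"

definition goto :: "label \<Rightarrow> config \<Rightarrow> config" where
  "goto l c = c\<lparr>pc := l\<rparr>"

definition branch :: "label \<Rightarrow> label \<Rightarrow> bool \<Rightarrow> config \<Rightarrow> config" where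
  "branch l0 l1 b c = goto (if b then l1 else l0) c"

abbreviation coin :: "bool pmf" where
  "coin \<equiv> bernoulli_pmf (1/2)"

text \<open>
  One call to bag \<open>k\<close>, returning the bit and the new configuration. Drawing the geometric variable
  \<open>G\<close> takes \<open>G + 1\<close> flips (flip until the first success), and assigning a fresh bit takes one more.
\<close>

definition call_bag :: "nat \<Rightarrow> config \<Rightarrow> (bool \<times> config) pmf" where
  "call_bag k c = do {
     g \<leftarrow> geometric_pmf (1/2);
     let j = 1 + g;
     let c1 = c\<lparr>flips := flips c + (g + 1)\<rparr>;
     (case bags c k j of
        Some b \<Rightarrow> return_pmf (b, c1)
      | None \<Rightarrow> do {
          b \<leftarrow> coin;
          return_pmf (b, c1\<lparr>bags := (bags c)(k := (bags c k)(j := Some b)), flips := flips c1 + 1\<rparr>)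
        })
   }"

text \<open>
  The parameter \<open>\<theta>\<close> is the bias of the input generator. Each \<^const>\<open>Input\<close> draws a fresh
  Bernoulli variable from it and does not count as a flip. \<^const>\<open>Decr\<close>, \<^const>\<open>Pop\<close> and
  \<^const>\<open>Remove\<close> jump to their first address, leaving the store unchanged, if the register is zero,
  respectively if the stack or string is empty.
\<close>

fun exec :: "real \<Rightarrow> instr \<Rightarrow> config \<Rightarrow> config pmf" where
  "exec \<theta> (Flip l0 l1) c = do {
     b \<leftarrow> coin;
     return_pmf (branch l0 l1 b (c\<lparr>flips := flips c + 1\<rparr>)) }"
| "exec \<theta> (Input l0 l1) c = do {
     b \<leftarrow> bernoulli_pmf \<theta>;
     return_pmf (branch l0 l1 b c) }"
| "exec \<theta> (Emit n l) c = return_pmf (goto l (c\<lparr>out_queue := out_queue c @ [n]\<rparr>))"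
| "exec \<theta> (EmitRegister r l) c = return_pmf (goto l (c\<lparr>out_queue := out_queue c @ [registers c r]\<rparr>))"
| "exec \<theta> (Incr r l) c =
     return_pmf (goto l (c\<lparr>registers := (registers c)(r := Suc (registers c r))\<rparr>))"
| "exec \<theta> (Decr r lz l) c = return_pmf (case registers c r of
       0 \<Rightarrow> goto lz c
     | Suc n \<Rightarrow> goto l (c\<lparr>registers := (registers c)(r := n)\<rparr>))"
| "exec \<theta> (Push s l) c = return_pmf (goto l (c\<lparr>stacks := (stacks c)(s := () # stacks c s)\<rparr>))"
| "exec \<theta> (Pop s le l) c = return_pmf (case stacks c s of
       [] \<Rightarrow> goto le c
     | _ # xs \<Rightarrow> goto l (c\<lparr>stacks := (stacks c)(s := xs)\<rparr>))"
| "exec \<theta> (Insert d t b l) c = return_pmf (goto l (c\<lparr>strings := (strings c)(t :=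
       (case d of Front \<Rightarrow> b # strings c t | Back \<Rightarrow> strings c t @ [b]))\<rparr>))"
| "exec \<theta> (Remove d t le l0 l1) c = return_pmf (
       if strings c t = [] then goto le c
       else (case d of
           Front \<Rightarrow> branch l0 l1 (hd (strings c t)) (c\<lparr>strings := (strings c)(t := tl (strings c t))\<rparr>)
         | Back \<Rightarrow> branch l0 l1 (last (strings c t))
                     (c\<lparr>strings := (strings c)(t := butlast (strings c t))\<rparr>)))"
| "exec \<theta> (CallBag k l0 l1) c = map_pmf (\<lambda>(b, c'). branch l0 l1 b c') (call_bag k c)"

text \<open>
  A machine halts when control leaves the program. The sub-distribution \<open>run M \<theta> c\<close> of the final
  configuration is the least fixed point of the recursion, so its missing mass is the probability
  that \<open>M\<close> started in \<open>c\<close> does not halt.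
\<close>

definition halted :: "machine \<Rightarrow> config \<Rightarrow> bool" where
  "halted M c \<longleftrightarrow> length M \<le> pc c"

partial_function (spmf) run :: "machine \<Rightarrow> real \<Rightarrow> config \<Rightarrow> config spmf" where
  "run M \<theta> c = (if halted M c then return_spmf c
                else bind_pmf (exec \<theta> (M ! pc c) c) (run M \<theta>))"

definition execution :: "machine \<Rightarrow> real \<Rightarrow> config spmf" where
  "execution M \<theta> = run M \<theta> initial"

text \<open>
  Equality with a full probability distribution includes halting with probability 1. The condition
  \<open>\<phi> \<theta> \<in> {0..1}\<close> is needed because \<^const>\<open>bernoulli_pmf\<close> truncates its argument to the unit interval.
\<close>

definition weakly_realizes :: "machine \<Rightarrow> real set \<Rightarrow> (real \<Rightarrow> real) \<Rightarrow> bool" where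
  "weakly_realizes M S \<phi> \<longleftrightarrow>
     (\<forall>\<theta>\<in>S. \<phi> \<theta> \<in> {0..1} \<and>
        map_spmf out_queue (execution M \<theta>) =
        spmf_of_pmf (map_pmf (\<lambda>b. [of_bool b]) (bernoulli_pmf (\<phi> \<theta>))))"

definition exponential_tails :: "machine \<Rightarrow> real \<Rightarrow> bool" where
  "exponential_tails M \<theta> \<longleftrightarrow>
     (\<exists>K \<rho>. 0 \<le> \<rho> \<and> \<rho> < 1 \<and>
        (\<forall>m. measure (measure_spmf (execution M \<theta>)) {c. flips c > m} \<le> K * \<rho> ^ m))"

definition strongly_realizes :: "machine \<Rightarrow> real set \<Rightarrow> (real \<Rightarrow> real) \<Rightarrow> bool" where
  "strongly_realizes M S \<phi> \<longleftrightarrow> weakly_realizes M S \<phi> \<and> (\<forall>\<theta>\<in>S. exponential_tails M \<theta>)"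

definition strongly_realizable :: "real set \<Rightarrow> (real \<Rightarrow> real) \<Rightarrow> bool" where
  "strongly_realizable S \<phi> \<longleftrightarrow> (\<exists>M. strongly_realizes M S \<phi>)"

definition strongly_realizable_with :: "resource set \<Rightarrow> real set \<Rightarrow> (real \<Rightarrow> real) \<Rightarrow> bool" where
  "strongly_realizable_with R S \<phi> \<longleftrightarrow> (\<exists>M. uses M \<subseteq> R \<and> strongly_realizes M S \<phi>)"

end

theory Submission
  imports Defs
begin

text \<open>
  A call to a bag returns \<open>\<upsilon>\<^sub>J\<close> with \<open>J\<close> geometric, so given the infinite binary expansion of \<open>U\<close>
  the calls are independent Bernoulli variables of parameter \<open>U\<close>. Revealing the digits of \<open>U\<close>
  only when they are asked for does not change the law of the run. A machine with one bag is thus a mixture,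
  over a uniform \<open>u\<close>, of machines in which a bag call is a coin of fixed bias \<open>u\<close>; for such a
  machine the probability \<open>v u\<close> of output 1 is found by solving linear equations, one for each
  instruction. Every machine below comes with a certificate consisting of this value \<open>v u\<close>, of a
  ranking function, which decreases by at least one in expectation at each step and so gives halting with
  probability 1, and of a weight, whose product with \<open>r\<close> to the number of flips is a supermartingale for some
  \<open>r > 1\<close>, which gives the exponential tails. The output parameter is the integral of \<open>v u\<close> over
  \<open>u\<close> in the unit interval, and each function of the theorem is written as such an integral.

  For the logarithm and the arc tangent, \<open>ln (1 + x)\<close> is the integral of \<open>x / (1 + x u)\<close> and
  \<open>arctan x\<close> that of \<open>x / (1 + (x u)\<^sup>2)\<close>. The number of successes
  before the first failure in independent trials of probability \<open>y\<close> is even with probability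
  \<open>1 / (1 + y)\<close>; here a trial consists of one input and one bag call, respectively of two of each, and
  only the parity is remembered, in the finite control.

  For the arc sine, let \<open>f k\<close> be the probability that a fair random walk returns to 0 for the first
  time at time \<open>2 k\<close>. The series of the arc sine is
  \<open>1/2 arcsin x = x (1/2 + 1/2 (\<Sum>k\<ge>1. f k x\<^bsup>2k\<^esup> (1 - 2 / (2 k + 1))))\<close>.
  A stack records the height of the walk, each of whose steps is allowed by one input, and
  \<open>2 / (2 k + 1)\<close> is the probability that \<open>2 k\<close> calls to one bag all agree, all ones and all zeros
  being equally likely.

  For the Gaussian integral, which is the integral of \<open>x exp (- a)\<close> with \<open>a = (x u)\<^sup>2 / 2\<close>,
  von Neumann's method is used. The coin of parameter \<open>a\<close> is made of two inputs, two bag calls and a flip.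
  Starting from \<open>V = 1\<close>, a stage succeeds if this coin succeeds and a fresh uniform number
  is less than the current \<open>V\<close>, which it then replaces. At least \<open>n\<close> stages succeed with probability
  \<open>a\<^sup>n / n!\<close>, so that an even number of them succeed with probability \<open>exp (- a)\<close>. The string register
  holds the known binary prefix of \<open>V\<close>.
\<close>

section \<open>Binary digits of a uniform real number\<close>

definition digit :: "nat \<Rightarrow> real \<Rightarrow> bool" where
  "digit j u \<longleftrightarrow> odd \<lfloor>2 ^ j * u\<rfloor>"

lemma floor_double: "\<lfloor>2 * x :: real\<rfloor> = 2 * \<lfloor>x\<rfloor> + of_bool (odd \<lfloor>2 * x\<rfloor>)"
proof -
  have "\<lfloor>2 * x\<rfloor> = 2 * \<lfloor>x\<rfloor> \<or> \<lfloor>2 * x\<rfloor> = 2 * \<lfloor>x\<rfloor> + 1"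
    by linarith
  then show ?thesis by auto
qed

lemma sum_digits:
  assumes "0 \<le> u" "u < 1"
  shows "(\<Sum>g<n. (1/2) ^ Suc g * of_bool (digit (Suc g) u)) = real_of_int \<lfloor>2 ^ n * u\<rfloor> / 2 ^ n"
proof (induction n)
  case 0
  show ?case using assms by (simp add: floor_eq_iff)
next
  case (Suc n)
  have "\<lfloor>2 ^ Suc n * u\<rfloor> = 2 * \<lfloor>2 ^ n * u\<rfloor> + of_bool (digit (Suc n) u)"
    using floor_double[of "2 ^ n * u"] by (simp add: digit_def mult.assoc)
  with Suc show ?case by (simp add: field_simps power_divide)
qed

text \<open>
  The reason why a bag call has bias \<open>u\<close>: the call reads digit \<open>Suc g\<close> with probability
  \<open>(1/2) ^ Suc g\<close>, so it returns 1 with the probability that has these digits.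
\<close>

lemma binary_expansion:
  assumes "0 \<le> u" "u < 1"
  shows "(\<lambda>g. (1/2) ^ Suc g * of_bool (digit (Suc g) u)) sums u"
proof -
  have lo: "u - (1/2) ^ n \<le> real_of_int \<lfloor>2 ^ n * u\<rfloor> / 2 ^ n" for n
  proof -
    have "2 ^ n * u - 1 \<le> real_of_int \<lfloor>2 ^ n * u\<rfloor>" by linarith
    then have "(2 ^ n * u - 1) / 2 ^ n \<le> real_of_int \<lfloor>2 ^ n * u\<rfloor> / 2 ^ n"
      by (rule divide_right_mono) simp
    then show ?thesis by (simp add: diff_divide_distrib power_divide)
  qed
  have hi: "real_of_int \<lfloor>2 ^ n * u\<rfloor> / 2 ^ n \<le> u" for n
    by (simp add: divide_le_eq mult.commute)
  have "(\<lambda>n. u - (1/2) ^ n) \<longlonglongrightarrow> u - 0"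
    by (intro tendsto_intros LIMSEQ_power_zero) simp
  then have "(\<lambda>n. u - (1/2) ^ n) \<longlonglongrightarrow> u"
    by (simp only: diff_zero)
  from tendsto_sandwich[OF _ _ this tendsto_const]
  have "(\<lambda>n. real_of_int \<lfloor>2 ^ n * u\<rfloor> / 2 ^ n) \<longlonglongrightarrow> u"
    using lo hi by (meson always_eventually)
  then show ?thesis
    by (simp only: sums_def sum_digits[OF assms])
qed

text \<open>
  There is no carry, as an even integer part does not cross a multiple of a larger power of two when it
  is increased by one. The second claim at \<open>k = 0\<close> says that the sum stays in the unit interval if the number lies there.
\<close>

lemma digit_add_power:
  assumes "\<not> digit j u"
  shows "digit k (u + (1/2) ^ j) \<longleftrightarrow> k = j \<or> digit k u"
    and "k < j \<Longrightarrow> \<lfloor>2 ^ k * (u + (1/2) ^ j)\<rfloor> = \<lfloor>2 ^ k * u\<rfloor>"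
proof -
  have less: "\<lfloor>2 ^ k * (u + (1/2) ^ j)\<rfloor> = \<lfloor>2 ^ k * u\<rfloor>" if "k < j" for k
  proof -
    from that obtain d where j: "j = k + Suc d" using less_imp_Suc_add by auto
    obtain m where m: "\<lfloor>2 ^ j * u\<rfloor> = 2 * m" using assms by (auto simp: digit_def)
    have scale: "\<lfloor>2 ^ k * x\<rfloor> = \<lfloor>2 ^ j * x\<rfloor> div 2 ^ Suc d" for x :: real
    proof -
      have "2 ^ k * x = 2 ^ j * x / of_int (2 ^ Suc d)" by (simp add: j power_add)
      then show ?thesis using floor_divide_real_eq_div[of "2 ^ Suc d" "2 ^ j * x"] by simp
    qed
    have "\<lfloor>2 ^ j * (u + (1/2) ^ j)\<rfloor> = 2 * m + 1"
      using m by (simp add: distrib_left power_one_over)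
    then have "\<lfloor>2 ^ k * (u + (1/2) ^ j)\<rfloor> = (2 * m + 1) div (2 * 2 ^ d)"
      by (simp add: scale)
    also have "\<dots> = (2 * m) div (2 * 2 ^ d)"
      by (simp add: zdiv_zmult2_eq)
    also have "\<dots> = \<lfloor>2 ^ k * u\<rfloor>" by (simp add: scale m)
    finally show ?thesis .
  qed
  then show "k < j \<Longrightarrow> \<lfloor>2 ^ k * (u + (1/2) ^ j)\<rfloor> = \<lfloor>2 ^ k * u\<rfloor>" .
  consider "k < j" | "k = j" | d where "k = j + Suc d"
    by (metis less_imp_Suc_add linorder_neqE_nat add_Suc_right)
  then show "digit k (u + (1/2) ^ j) \<longleftrightarrow> k = j \<or> digit k u"
  proof cases
    case 1
    then show ?thesis using less by (simp add: digit_def)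
  next
    case 2
    then show ?thesis using assms by (simp add: digit_def distrib_left power_one_over)
  next
    case 3
    have "\<lfloor>2 ^ k * (u + (1/2) ^ j)\<rfloor> = \<lfloor>2 ^ k * u + of_int (2 ^ Suc d)\<rfloor>"
      by (simp add: 3 power_add distrib_left power_one_over)
    also have "\<dots> = \<lfloor>2 ^ k * u\<rfloor> + 2 ^ Suc d" by (rule floor_add_int[symmetric])
    finally show ?thesis using 3 by (simp add: digit_def)
  qed
qed

lemma measurable_digit [measurable]: "Measurable.pred borel (digit j)"
  unfolding digit_def by measurable

text \<open>
  The bag contents that are consistent with the digits revealed so far. Index 0 of a bag is never
  assigned, hence the \<open>Suc\<close>.
\<close>

definition cylinder :: "(nat \<Rightarrow> bool option) \<Rightarrow> real set" where
  "cylinder \<beta> = {u. 0 \<le> u \<and> u < 1 \<and> (\<forall>j b. \<beta> (Suc j) = Some b \<longrightarrow> digit (Suc j) u = b)}"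

lemma cylinder_empty: "cylinder (\<lambda>_. None) = {0..<1}"
  by (auto simp: cylinder_def)

lemma sets_cylinder [measurable]: "cylinder \<beta> \<in> sets borel"
proof -
  have "Measurable.pred borel (\<lambda>u. 0 \<le> u \<and> u < 1 \<and> (\<forall>j b. \<beta> (Suc j) = Some b \<longrightarrow> digit (Suc j) u = b))"
    by measurable
  then show ?thesis by (simp add: cylinder_def pred_def)
qed

lemma cylinder_upd:
  assumes "\<beta> (Suc j) = None"
  shows "cylinder (\<beta>(Suc j := Some b)) = cylinder \<beta> \<inter> {u. digit (Suc j) u = b}"
  using assms by (auto simp: cylinder_def split: if_splits)

lemma emeasure_cylinder_le: "emeasure lborel (cylinder \<beta>) \<le> 1"
proof -
  have "emeasure lborel (cylinder \<beta>) \<le> emeasure lborel {0..<1::real}"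
    by (rule emeasure_mono) (auto simp: cylinder_def)
  then show ?thesis by simp
qed

text \<open>
  An unrevealed digit is a fair coin given the revealed ones: translation by its place value turns its
  zeros into ones, keeps all other digits, and preserves Lebesgue measure.
\<close>

lemma emeasure_cylinder_upd:
  assumes "\<beta> (Suc j) = None"
  shows "emeasure lborel (cylinder (\<beta>(Suc j := Some b))) = emeasure lborel (cylinder \<beta>) / 2"
proof -
  let ?C = "\<lambda>b. cylinder (\<beta>(Suc j := Some b))"
  let ?h = "(1/2) ^ Suc j :: real"
  have memb: "u + ?h \<in> ?C True \<longleftrightarrow> u \<in> ?C False" if "\<not> digit (Suc j) u" for u
  proof -
    have "\<lfloor>u + ?h\<rfloor> = \<lfloor>u\<rfloor>" using digit_add_power(2)[OF that, of 0] by simp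
    then have "(0 \<le> u + ?h \<and> u + ?h < 1) = (0 \<le> u \<and> u < 1)"
      by (metis floor_eq_iff add_0 of_int_0)
    then show ?thesis using that assms digit_add_power(1)[OF that]
      by (auto simp: cylinder_def simp del: power_Suc split: if_splits)
  qed
  have shift: "(\<lambda>u. u + ?h) -` ?C True = ?C False"
  proof (intro set_eqI iffI)
    fix u assume "u \<in> ?C False"
    moreover from this have "\<not> digit (Suc j) u" using assms by (simp add: cylinder_upd)
    ultimately show "u \<in> (\<lambda>u. u + ?h) -` ?C True" using memb by simp
  next
    fix u assume u: "u \<in> (\<lambda>u. u + ?h) -` ?C True"
    have "\<not> digit (Suc j) u"
    proof
      assume "digit (Suc j) u"
      moreover have "\<lfloor>2 ^ Suc j * (u + ?h)\<rfloor> = \<lfloor>2 ^ Suc j * u\<rfloor> + 1"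
        by (simp only: distrib_left) (simp add: power_one_over)
      ultimately have "\<not> digit (Suc j) (u + ?h)" by (simp add: digit_def del: power_Suc)
      with u show False using assms by (simp add: cylinder_upd del: power_Suc)
    qed
    with u memb show "u \<in> ?C False" by simp
  qed
  have "emeasure lborel (?C True) = emeasure (distr lborel borel ((+) ?h)) (?C True)"
    by (simp only: lborel_distr_plus)
  also have "\<dots> = emeasure lborel (?C False)"
    using shift by (subst emeasure_distr) (simp_all add: add.commute[of _ ?h] del: power_Suc)
  finally have eq: "emeasure lborel (?C True) = emeasure lborel (?C False)" .
  have "cylinder \<beta> = ?C True \<union> ?C False" "?C True \<inter> ?C False = {}"
    using assms by (auto simp: cylinder_upd)
  then have "emeasure lborel (cylinder \<beta>) = emeasure lborel (?C True) + emeasure lborel (?C False)"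
    by (simp add: plus_emeasure)
  then have "emeasure lborel (cylinder \<beta>) = 2 * emeasure lborel (?C b)"
    using eq by (cases b) (simp_all add: mult_2)
  then show ?thesis
    by (simp add: mult_divide_eq_ennreal mult.commute[of 2])
qed

section \<open>Averaging an instruction over the bag\<close>

text \<open>
  What a program that uses one bag, one stack and one string register can observe: its address, the
  height of its unary stack, its string and its output. The bag content and the flip count are left out, since
  the former is averaged over and the latter does not influence the run.
\<close>

type_synonym state = "label \<times> nat \<times> bool list \<times> nat list"

definition view :: "config \<Rightarrow> state" where
  "view c = (pc c, length (stacks c 0), strings c 0, out_queue c)"

text \<open>
  Every instruction is modelled as drawing one bit and then moving deterministically, where bits of bias 0
  stand for no draw at all. In this idealised semantics a bag call draws a fresh bit of bias \<open>u\<close>.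
\<close>

fun bias :: "real \<Rightarrow> real \<Rightarrow> instr \<Rightarrow> real" where
  "bias u \<theta> (Flip l0 l1) = 1/2"
| "bias u \<theta> (Input l0 l1) = \<theta>"
| "bias u \<theta> (CallBag k l0 l1) = u"
| "bias u \<theta> i = 0"

fun succ_state :: "instr \<Rightarrow> bool \<Rightarrow> state \<Rightarrow> state" where
  "succ_state (Flip l0 l1) b (l, h, s, out) = (if b then l1 else l0, h, s, out)"
| "succ_state (Input l0 l1) b (l, h, s, out) = (if b then l1 else l0, h, s, out)"
| "succ_state (CallBag k l0 l1) b (l, h, s, out) = (if b then l1 else l0, h, s, out)"
| "succ_state (Emit n l1) b (l, h, s, out) = (l1, h, s, out @ [n])"
| "succ_state (Push k l1) b (l, h, s, out) = (l1, Suc h, s, out)"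
| "succ_state (Pop k le l1) b (l, h, s, out) = (if h = 0 then (le, h, s, out) else (l1, h - 1, s, out))"
| "succ_state (Insert d t x l1) b (l, h, s, out) =
     (l1, h, (case d of Front \<Rightarrow> x # s | Back \<Rightarrow> s @ [x]), out)"
| "succ_state (Remove d t le l0 l1) b (l, h, s, out) =
     (if s = [] then (le, h, s, out)
      else (case d of
          Front \<Rightarrow> (if hd s then l1 else l0, h, tl s, out)
        | Back \<Rightarrow> (if last s then l1 else l0, h, butlast s, out)))"
| "succ_state i b z = z"

definition mean :: "real \<Rightarrow> real \<Rightarrow> instr \<Rightarrow> (state \<Rightarrow> real) \<Rightarrow> state \<Rightarrow> real" where
  "mean u \<theta> i f z = (1 - bias u \<theta> i) * f (succ_state i False z) + bias u \<theta> i * f (succ_state i True z)"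

definition nn_mean :: "real \<Rightarrow> real \<Rightarrow> instr \<Rightarrow> (state \<Rightarrow> ennreal) \<Rightarrow> state \<Rightarrow> ennreal" where
  "nn_mean u \<theta> i f z =
     ennreal (1 - bias u \<theta> i) * f (succ_state i False z) + ennreal (bias u \<theta> i) * f (succ_state i True z)"

abbreviation basic_resources :: "resource set" where
  "basic_resources \<equiv> {Bag 0, Stack 0, StringRegister 0}"

text \<open>
  The bias \<open>1/2\<close> stands for any hidden \<open>u\<close> strictly between 0 and 1, all of which allow the same bits.
  Bit 1 of the input generator is excluded for parameter 0, since the value function of the machine for the
  Gaussian integral divides by the parameter after such a bit.
\<close>

definition possible :: "real \<Rightarrow> instr \<Rightarrow> bool \<Rightarrow> bool" where
  "possible \<theta> i b \<longleftrightarrow> b \<longrightarrow> bias (1/2) \<theta> i > 0"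

text \<open>
  The conditional expectation of \<open>f U\<close> given the digits of \<open>U\<close> that the configuration has revealed.
\<close>

definition lift :: "(real \<Rightarrow> state \<Rightarrow> ennreal) \<Rightarrow> config \<Rightarrow> ennreal" where
  "lift f c = (\<integral>\<^sup>+u\<in>cylinder (bags c 0). f u (view c) \<partial>lborel) / emeasure lborel (cylinder (bags c 0))"

definition sound :: "config \<Rightarrow> bool" where
  "sound c \<longleftrightarrow> emeasure lborel (cylinder (bags c 0)) \<noteq> 0"

lemma view_simps [simp]:
  "view (c\<lparr>flips := n\<rparr>) = view c"
  "view (c\<lparr>bags := B\<rparr>) = view c"
  by (simp_all add: view_def)

text \<open>
  The factor by which an instruction may increase the exponential moment of the number of flips. A bag call
  takes a random number of flips, whose moment is below any \<open>q > 1\<close> once the base is close enough to 1.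
\<close>

fun flip_cost :: "real \<Rightarrow> instr \<Rightarrow> real" where
  "flip_cost q (Flip l0 l1) = q"
| "flip_cost q (CallBag k l0 l1) = q"
| "flip_cost q i = 1"

lemma exec_cases:
  assumes "resources i \<subseteq> basic_resources"
  obtains (Flip) l0 l1 where "i = Flip l0 l1"
    | (Input) l0 l1 where "i = Input l0 l1"
    | (CallBag) l0 l1 where "i = CallBag 0 l0 l1"
    | (det) c' where "exec \<theta> i c = return_pmf c'" "view c' = succ_state i False (view c)"
        "bags c' = bags c" "flips c' = flips c" "\<And>u. bias u \<theta> i = 0" "\<And>q. flip_cost q i = 1"
proof (cases i)
  case (Remove d t le l0 l1)
  show ?thesis
    by (rule det, unfold Remove, rule exec.simps)
      (use Remove assms in \<open>auto simp: view_def goto_def branch_def split: side.split\<close>)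
next
  case (Pop s le l)
  show ?thesis
    by (rule det, unfold Pop, rule exec.simps)
      (use Pop assms in \<open>auto simp: view_def goto_def split: list.split\<close>)
qed (use assms that in \<open>auto simp: view_def goto_def\<close>)

text \<open>
  Lazy and immediate sampling of the bag agree. In a bag call, for each drawn index \<open>j\<close> the two branches
  contribute the averages of \<open>f\<close> over the two halves of the cylinder cut out by digit \<open>j\<close>, or, when \<open>j\<close> is
  already revealed, the average over the whole cylinder, on which the digit is constant. In both cases
  this is the average of \<open>f\<close> at the state selected by the true digit of \<open>u\<close>. Summing over \<open>j\<close> with its
  geometric weights and exchanging sum and integral leaves a coin of bias \<open>u\<close>.
\<close>

lemma nn_integral_exec_lift:
  assumes i: "resources i \<subseteq> basic_resources" and \<theta>: "0 \<le> \<theta>" "\<theta> \<le> 1"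
    and f [measurable]: "\<And>z. (\<lambda>u. f u z) \<in> borel_measurable borel"
  shows "(\<integral>\<^sup>+c'. lift f c' \<partial>exec \<theta> i c) = lift (\<lambda>u. nn_mean u \<theta> i (f u)) c"
proof -
  have two: "lift f c0 * ennreal (1 - p) + lift f c1 * ennreal p
             = lift (\<lambda>u z. ennreal (1 - p) * f u (z0 z) + ennreal p * f u (z1 z)) c"
    if "bags c0 = bags c" "bags c1 = bags c" "view c0 = z0 (view c)" "view c1 = z1 (view c)" for c0 c1 p z0 z1
    using that
    by (simp add: lift_def distrib_right nn_integral_add nn_integral_cmult mult.assoc
        add_divide_distrib_ennreal) (simp add: divide_ennreal_def ac_simps)
  show ?thesis
    using i
  proof (cases rule: exec_cases[where i = i and \<theta> = \<theta> and c = c])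
    case (det c')
    then show ?thesis by (simp add: lift_def nn_mean_def)
  next
    case (CallBag l0 l1)
    define \<beta> where "\<beta> = bags c 0"
    define N where "N = emeasure lborel (cylinder \<beta>)"
    define z where "z b = succ_state i b (view c)" for b
    have view_br: "view (branch l0 l1 b c') = z b" if "view c' = view c" for b c'
      using that by (auto simp: z_def CallBag view_def branch_def goto_def)
    have bags_br: "bags (branch l0 l1 b c') = bags c'" for b c'
      by (simp add: branch_def goto_def)
    define X where "X j = (\<integral>\<^sup>+u\<in>cylinder \<beta>. f u (z (digit j u)) \<partial>lborel) / N" for j
    have meas: "(\<lambda>u. f u (z (digit j u))) \<in> borel_measurable borel" for j
    proof -
      have "(\<lambda>u. f u (z (digit j u))) = (\<lambda>u. if digit j u then f u (z True) else f u (z False))"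
        by auto
      then show ?thesis by simp
    qed
    note meas [measurable]
    have step: "(\<integral>\<^sup>+p. lift f (case p of (b, c') \<Rightarrow> branch l0 l1 b c') \<partial>
        (case bags c 0 (Suc g) of Some b \<Rightarrow> return_pmf (b, c\<lparr>flips := n\<rparr>)
         | None \<Rightarrow> coin \<bind> (\<lambda>b. return_pmf (b, c\<lparr>flips := n, bags := (bags c)(0 := (bags c 0)(Suc g := Some b)), flips := m\<rparr>))))
        = X (Suc g)" for g n m
    proof (cases "\<beta> (Suc g)")
      case (Some b)
      then have "(\<integral>\<^sup>+u\<in>cylinder \<beta>. f u (z (digit (Suc g) u)) \<partial>lborel) = (\<integral>\<^sup>+u\<in>cylinder \<beta>. f u (z b) \<partial>lborel)"
        by (intro nn_integral_cong) (auto simp: cylinder_def indicator_def)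
      then show ?thesis using Some
        by (simp add: \<beta>_def[symmetric] lift_def view_br bags_br X_def N_def)
    next
      case None
      have half: "lift f (branch l0 l1 b (c\<lparr>flips := n, bags := (bags c)(0 := (bags c 0)(Suc g := Some b)), flips := m\<rparr>)) * ennreal (1/2)
          = (\<integral>\<^sup>+u. f u (z b) * indicator (cylinder \<beta> \<inter> {u. digit (Suc g) u = b}) u \<partial>lborel) / N" for b
      proof -
        have "x / (N / 2) * ennreal (1/2) = x / N" for x
        proof -
          have fin: "N \<noteq> \<top>" using emeasure_cylinder_le[of \<beta>] by (auto simp: N_def top_unique)
          have two: "inverse (inverse (2::ennreal)) = 2"
            using inverse_ennreal[of "1/2"] by simp
          have "inverse (2::ennreal) < \<top>"
            using ennreal_less_top[of "1/2"] by (simp only: ennreal_half)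
          with fin have "inverse (N * inverse 2) = inverse N * 2"
            by (simp add: ennreal_inverse_mult two top.not_eq_extremum)
          moreover have "2 * inverse 2 = (1::ennreal)"
            using ennreal_divide_self[of 2] by (simp add: divide_ennreal_def)
          ultimately show ?thesis by (simp add: divide_ennreal_def mult.assoc)
        qed
        then show ?thesis
          by (simp add: \<beta>_def[symmetric] lift_def view_br bags_br N_def cylinder_upd[of \<beta>, OF None, symmetric]
              emeasure_cylinder_upd[of \<beta>, OF None])
      qed
      have "X (Suc g) = ((\<integral>\<^sup>+u. f u (z True) * indicator (cylinder \<beta> \<inter> {u. digit (Suc g) u = True}) u \<partial>lborel)
         + (\<integral>\<^sup>+u. f u (z False) * indicator (cylinder \<beta> \<inter> {u. digit (Suc g) u = False}) u \<partial>lborel)) / N"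
        unfolding X_def
        by (subst nn_integral_add[symmetric])
          (auto intro!: nn_integral_cong arg_cong[where f="\<lambda>x. x / N"] simp: indicator_def)
      then show ?thesis using None half[of True] half[of False]
        by (simp add: \<beta>_def[symmetric] add_divide_distrib_ennreal)
    qed
    have "(\<integral>\<^sup>+c'. lift f c' \<partial>exec \<theta> i c) = (\<integral>\<^sup>+g. X (Suc g) \<partial>geometric_pmf (1/2))"
      unfolding CallBag exec.simps call_bag_def Let_def
        plus_1_eq_Suc nn_integral_map_pmf nn_integral_bind_pmf
      by (intro nn_integral_cong step)
    also have "\<dots> = (\<Sum>g. ennreal ((1/2) ^ Suc g) * X (Suc g))"
      by (simp add: nn_integral_measure_pmf nn_integral_count_space_nat)
    also have "\<dots> = (\<Sum>g. \<integral>\<^sup>+u. (ennreal ((1/2) ^ Suc g) * f u (z (digit (Suc g) u))) * indicator (cylinder \<beta>) u \<partial>lborel) / N"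
    proof -
      have "ennreal a * X (Suc g)
          = (\<integral>\<^sup>+u. (ennreal a * f u (z (digit (Suc g) u))) * indicator (cylinder \<beta>) u \<partial>lborel) * inverse N" for a g
      proof -
        have "(\<lambda>u. f u (z (digit (Suc g) u)) * indicator (cylinder \<beta>) u) \<in> borel_measurable lborel"
          by simp
        from nn_integral_cmult[OF this, of "ennreal a"] show ?thesis
          by (simp only: X_def divide_ennreal_def mult.assoc)
      qed
      then show ?thesis
        unfolding divide_ennreal_def ennreal_suminf_multc[symmetric] by (intro suminf_cong)
    qed
    also have "(\<Sum>g. \<integral>\<^sup>+u. (ennreal ((1/2) ^ Suc g) * f u (z (digit (Suc g) u))) * indicator (cylinder \<beta>) u \<partial>lborel)
        = (\<integral>\<^sup>+u. (\<Sum>g. (ennreal ((1/2) ^ Suc g) * f u (z (digit (Suc g) u))) * indicator (cylinder \<beta>) u) \<partial>lborel)"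
      by (rule nn_integral_suminf[symmetric]) measurable
    also have "\<dots> = (\<integral>\<^sup>+u\<in>cylinder \<beta>. nn_mean u \<theta> i (f u) (view c) \<partial>lborel)"
    proof (intro nn_integral_cong)
      fix u :: real
      show "(\<Sum>g. (ennreal ((1/2) ^ Suc g) * f u (z (digit (Suc g) u))) * indicator (cylinder \<beta>) u)
          = nn_mean u \<theta> i (f u) (view c) * indicator (cylinder \<beta>) u"
      proof (cases "u \<in> cylinder \<beta>")
        case True
        then have u: "0 \<le> u" "u < 1" by (auto simp: cylinder_def)
        note ones = binary_expansion[OF u]
        have zeros: "(\<lambda>g. (1/2) ^ Suc g * of_bool (\<not> digit (Suc g) u)) sums (1 - u)"
        proof -
          have "(\<lambda>g. (1/2) ^ Suc g * of_bool (\<not> digit (Suc g) u))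
              = (\<lambda>g. (1/2) ^ Suc g - (1/2) ^ Suc g * of_bool (digit (Suc g) u) :: real)"
            by (rule ext) (simp only: of_bool_not_iff right_diff_distrib mult_1_right)
          with sums_diff[OF power_half_series ones] show ?thesis by (simp only:)
        qed
        have "(\<Sum>g. ennreal ((1/2) ^ Suc g) * f u (z (digit (Suc g) u)))
          = (\<Sum>g. ennreal ((1/2) ^ Suc g * of_bool (\<not> digit (Suc g) u)) * f u (z False)
               + ennreal ((1/2) ^ Suc g * of_bool (digit (Suc g) u)) * f u (z True))"
          by (intro suminf_cong) (auto simp del: power_Suc)
        also have "\<dots> = ennreal (1 - u) * f u (z False) + ennreal u * f u (z True)"
        proof -
          have "(\<Sum>g. ennreal ((1/2) ^ Suc g * of_bool (\<not> digit (Suc g) u))) = ennreal (1 - u)"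
            by (rule suminf_ennreal_eq[OF _ zeros]) simp
          moreover have "(\<Sum>g. ennreal ((1/2) ^ Suc g * of_bool (digit (Suc g) u))) = ennreal u"
            by (rule suminf_ennreal_eq[OF _ ones]) simp
          ultimately show ?thesis
            by (subst suminf_add[symmetric]) (simp_all only: ennreal_suminf_multc summableI)
        qed
        finally show ?thesis using True by (simp add: nn_mean_def z_def CallBag del: power_Suc)
      qed simp
    qed
    finally show ?thesis by (simp add: lift_def \<beta>_def N_def)
  next
    case (Flip l0 l1)
    show ?thesis
      using two[of "branch l0 l1 False (c\<lparr>flips := flips c + 1\<rparr>)" "branch l0 l1 True (c\<lparr>flips := flips c + 1\<rparr>)"
          "succ_state i False" "succ_state i True" "1/2"]
      by (simp add: Flip nn_mean_def[abs_def] branch_def goto_def view_def add.commute)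
  next
    case (Input l0 l1)
    show ?thesis
      using two[of "branch l0 l1 False c" "branch l0 l1 True c" "succ_state i False" "succ_state i True" \<theta>] \<theta>
      by (simp add: Input nn_mean_def[abs_def] branch_def goto_def view_def add.commute)
  qed
qed

section \<open>Comparison with superharmonic functions\<close>

lemma pmf_eqI_le:
  assumes le: "\<And>x. pmf p x \<le> pmf q x"
  shows "p = q"
proof (rule pmf_eqI)
  fix x
  have "(\<integral>\<^sup>+y. ennreal (pmf q y) - ennreal (pmf p y) \<partial>count_space UNIV)
      = (\<integral>\<^sup>+y. ennreal (pmf q y) \<partial>count_space UNIV) - (\<integral>\<^sup>+y. ennreal (pmf p y) \<partial>count_space UNIV)"
    using le by (intro nn_integral_diff) (auto simp: nn_integral_pmf)
  also have "\<dots> = 0" by (simp add: nn_integral_pmf)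
  finally have "ennreal (pmf q x) - ennreal (pmf p x) = 0"
    by (simp add: nn_integral_0_iff_AE AE_count_space)
  then show "pmf p x = pmf q x"
    using le[of x] by (simp add: diff_eq_0_iff_ennreal antisym)
qed

lemma ennreal_le_of_le_add:
  fixes a b c :: ennreal
  assumes le: "\<And>n. of_nat n * a \<le> of_nat n * b + c" and c: "c < \<top>"
  shows "a \<le> b"
proof (rule ennreal_le_epsilon)
  fix e :: real assume e: "0 < e"
  obtain r where r: "c = ennreal r" "0 \<le> r" using c by (cases c) auto
  obtain n :: nat where n: "r / e < real n" using reals_Archimedean2 by blast
  have n0: "0 < n" using n r e by (metis divide_nonneg_pos gr0I le_less_trans of_nat_0 order_less_irrefl)
  have "c \<le> of_nat n * ennreal e"
    using n e r by (simp add: r ennreal_of_nat_eq_real_of_nat ennreal_mult'[symmetric] ennreal_leI field_simps)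
  then have "of_nat n * a \<le> of_nat n * (b + ennreal e)"
    using le[of n] by (simp add: distrib_left) (meson add_left_mono order_trans)
  then show "a \<le> b + ennreal e"
    using n0 by (simp add: ennreal_mult_le_mult_iff)
qed

text \<open>
  Let \<open>A\<close> be the probability of ending in \<open>X\<close>. It is harmonic, at most 1, and below \<open>B\<close> on final
  configurations. Since \<open>R\<close> decreases by at least 1 in expectation, induction on \<open>n\<close> gives
  \<open>n A \<le> n B + R\<close>, whence \<open>A \<le> B\<close> as \<open>R\<close> is finite. Taking \<open>{None}\<close> for \<open>X\<close> and 0 for \<open>B\<close>
  yields halting with probability 1. Upper bounds are enough later on: bounds for the probabilities of the
  two outputs and of everything else that add up to 1 must be equalities.
\<close>

lemma run_le_superharmonic:
  assumes inv: "\<And>c c'. Inv c \<Longrightarrow> \<not> halted M c \<Longrightarrow> c' \<in> set_pmf (exec \<theta> (M ! pc c) c) \<Longrightarrow> Inv c'"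
    and R: "\<And>c. Inv c \<Longrightarrow> \<not> halted M c \<Longrightarrow> 1 + (\<integral>\<^sup>+c'. R c' \<partial>exec \<theta> (M ! pc c) c) \<le> R c"
    and B: "\<And>c. Inv c \<Longrightarrow> \<not> halted M c \<Longrightarrow> (\<integral>\<^sup>+c'. B c' \<partial>exec \<theta> (M ! pc c) c) \<le> B c"
    and final: "\<And>c. Inv c \<Longrightarrow> halted M c \<Longrightarrow> Some c \<in> X \<Longrightarrow> 1 \<le> B c"
    and c: "Inv c" and fin: "R c < \<top>"
  shows "emeasure (measure_pmf (run M \<theta> c)) X \<le> (B c :: ennreal)"
proof (rule ennreal_le_of_le_add[OF _ fin])
  define A where "A c = emeasure (measure_pmf (run M \<theta> c)) X" for c
  have A1: "A c \<le> 1" for c by (simp add: A_def measure_pmf.emeasure_le_1)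
  have Astep: "A c = (\<integral>\<^sup>+c'. A c' \<partial>exec \<theta> (M ! pc c) c)" if "\<not> halted M c" for c
    unfolding A_def using that by (subst run.simps) simp
  have Afinal: "A c \<le> B c" if "Inv c" "halted M c" for c
    unfolding A_def using final[OF that] that
    by (subst run.simps) (auto simp: indicator_def)
  fix n
  show "of_nat n * emeasure (measure_pmf (run M \<theta> c)) X \<le> of_nat n * B c + R c"
    unfolding A_def[symmetric] using c
  proof (induction n arbitrary: c)
    case 0
    show ?case by simp
  next
    case (Suc n)
    show ?case
    proof (cases "halted M c")
      case True
      then have "of_nat (Suc n) * A c \<le> of_nat (Suc n) * B c"
        using Afinal[OF Suc.prems] by (intro mult_left_mono) auto
      also have "\<dots> \<le> of_nat (Suc n) * B c + R c" by simp
      finally show ?thesis .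
    next
      case False
      let ?p = "exec \<theta> (M ! pc c) c"
      have "of_nat (Suc n) * A c = A c + of_nat n * A c" by (simp add: distrib_right)
      also have "\<dots> \<le> 1 + (\<integral>\<^sup>+c'. of_nat n * A c' \<partial>?p)"
        using A1[of c] Astep[OF False] by (simp add: nn_integral_cmult add_right_mono)
      also have "\<dots> \<le> 1 + (\<integral>\<^sup>+c'. of_nat n * B c' + R c' \<partial>?p)"
        using inv[OF Suc.prems False]
        by (intro add_left_mono nn_integral_mono_AE) (auto simp: AE_measure_pmf_iff intro!: Suc.IH)
      also have "\<dots> = of_nat n * (\<integral>\<^sup>+c'. B c' \<partial>?p) + (1 + (\<integral>\<^sup>+c'. R c' \<partial>?p))"
        by (simp add: nn_integral_add nn_integral_cmult)
      also have "\<dots> \<le> of_nat n * B c + R c"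
        using B[OF Suc.prems False] R[OF Suc.prems False] by (intro add_mono mult_left_mono) auto
      also have "\<dots> \<le> of_nat (Suc n) * B c + R c"
        by (intro add_right_mono mult_right_mono) auto
      finally show ?thesis .
    qed
  qed
qed

section \<open>Exponential moments of the number of flips\<close>

lemma geometric_moment:
  assumes "0 \<le> r" "r < 2"
  shows "(\<integral>\<^sup>+g. ennreal (r ^ (g + 2)) \<partial>geometric_pmf (1/2)) = ennreal (r\<^sup>2 / (2 - r))"
proof -
  have "(\<lambda>g. (r\<^sup>2 / 2) * (r / 2) ^ g) sums ((r\<^sup>2 / 2) * (1 / (1 - r / 2)))"
    using assms by (intro sums_mult geometric_sums) simp
  also have "(r\<^sup>2 / 2) * (1 / (1 - r / 2)) = r\<^sup>2 / (2 - r)"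
    using assms by (simp add: field_simps)
  also have "(\<lambda>g. (r\<^sup>2 / 2) * (r / 2) ^ g) = (\<lambda>g. (1/2) ^ g * (1/2) * r ^ (g + 2))"
    by (simp add: fun_eq_iff power_divide power_add power2_eq_square)
  finally have sums: "(\<lambda>g. (1/2) ^ g * (1/2) * r ^ (g + 2)) sums (r\<^sup>2 / (2 - r))" .
  have "(\<integral>\<^sup>+g. ennreal (r ^ (g + 2)) \<partial>geometric_pmf (1/2)) = (\<Sum>g. ennreal ((1/2) ^ g * (1/2) * r ^ (g + 2)))"
    unfolding nn_integral_measure_pmf nn_integral_count_space_nat
    using assms by (intro suminf_cong) (subst ennreal_mult'', simp_all)
  also have "\<dots> = ennreal (r\<^sup>2 / (2 - r))"
    using assms by (intro suminf_ennreal_eq sums) simp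
  finally show ?thesis .
qed

lemma nn_integral_bernoulli_ennreal:
  assumes "0 \<le> p" "p \<le> 1" "\<And>b. 0 \<le> f b"
  shows "(\<integral>\<^sup>+b. ennreal (f b) \<partial>bernoulli_pmf p) = ennreal ((1 - p) * f False + p * f True)"
  using assms by (subst nn_integral_bernoulli_pmf) (simp_all add: ennreal_mult'' ennreal_plus mult.commute add.commute)

text \<open>
  The number of flips of a bag call is correlated with the bit that it returns, so the weight is bounded by its maximum
  over the two branches. This is why the condition on \<open>w\<close> includes \<open>u = 0\<close> and \<open>u = 1\<close>, where a single branch
  remains.
\<close>

lemma nn_integral_exec_flips:
  assumes i: "resources i \<subseteq> basic_resources" and \<theta>: "0 \<le> \<theta>" "\<theta> \<le> 1"
    and r: "1 \<le> r" "r < 2" "r\<^sup>2 / (2 - r) \<le> q"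
    and w0: "\<And>z. 0 \<le> w z"
    and w: "\<And>u. 0 \<le> u \<Longrightarrow> u \<le> 1 \<Longrightarrow> flip_cost q i * mean u \<theta> i w (view c) \<le> w (view c)"
  shows "(\<integral>\<^sup>+c'. ennreal (r ^ flips c' * w (view c')) \<partial>exec \<theta> i c) \<le> ennreal (r ^ flips c * w (view c))"
proof -
  have rq: "r \<le> q"
  proof -
    have "r * (2 - r) \<le> r\<^sup>2" using mult_left_mono[of 1 r r] r by (simp add: power2_eq_square algebra_simps)
    then have "r \<le> r\<^sup>2 / (2 - r)" using r by (simp add: pos_le_divide_eq)
    then show ?thesis using r by simp
  qed
  show ?thesis
    using i
  proof (cases rule: exec_cases[where i = i and \<theta> = \<theta> and c = c])
    case (det c')
    then show ?thesis using w[of 0] r by (simp add: mean_def ennreal_leI mult_left_mono)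
  next
    case (CallBag l0 l1)
    define m where "m = max (w (succ_state i False (view c))) (w (succ_state i True (view c)))"
    have m0: "0 \<le> m" using w0 by (simp add: m_def le_max_iff_disj)
    have qm: "q * m \<le> w (view c)"
      using w[of 0] w[of 1] by (simp add: m_def mean_def CallBag max_def)
    have wm: "w (view (branch l0 l1 b c')) \<le> m" if "view c' = view c" for b c'
      using that by (auto simp: m_def CallBag view_def branch_def goto_def)
    have fl: "flips (branch l0 l1 b c') = flips c'" for b c'
      by (simp add: branch_def goto_def)
    have bound: "ennreal (r ^ flips (branch l0 l1 b c') * w (view (branch l0 l1 b c')))
        \<le> ennreal (r ^ flips c * m) * ennreal (r ^ (g + 2))"
      if "view c' = view c" "flips c' \<le> flips c + (g + 2)" for b c' g
    proof -
      have "r ^ flips c' * w (view (branch l0 l1 b c')) \<le> r ^ (flips c + (g + 2)) * m"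
        using that r m0 wm w0 by (intro mult_mono power_increasing) auto
      then show ?thesis using r m0
        by (simp add: fl ennreal_mult'[symmetric] power_add ac_simps ennreal_leI)
    qed
    have "(\<integral>\<^sup>+c'. ennreal (r ^ flips c' * w (view c')) \<partial>exec \<theta> i c)
      \<le> (\<integral>\<^sup>+g. ennreal (r ^ flips c * m) * ennreal (r ^ (g + 2)) \<partial>geometric_pmf (1/2))"
      unfolding CallBag exec.simps call_bag_def Let_def nn_integral_map_pmf nn_integral_bind_pmf
    proof (intro nn_integral_mono)
      fix g
      show "(\<integral>\<^sup>+p. ennreal (r ^ flips (case p of (b, c') \<Rightarrow> branch l0 l1 b c') * w (view (case p of (b, c') \<Rightarrow> branch l0 l1 b c')))
         \<partial>(case bags c 0 (1 + g) of
             None \<Rightarrow> coin \<bind> (\<lambda>b. return_pmf (b, c\<lparr>flips := flips c + (g + 1), bags := (bags c)(0 := (bags c 0)(1 + g := Some b)),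
                 flips := flips (c\<lparr>flips := flips c + (g + 1)\<rparr>) + 1\<rparr>))
           | Some b \<Rightarrow> return_pmf (b, c\<lparr>flips := flips c + (g + 1)\<rparr>)))
         \<le> ennreal (r ^ flips c * m) * ennreal (r ^ (g + 2))"
      proof (cases "bags c 0 (1 + g)")
        case None
        show ?thesis unfolding None option.case nn_integral_bind_pmf
          by (rule order_trans[OF nn_integral_mono[where v = "\<lambda>_. ennreal (r ^ flips c * m) * ennreal (r ^ (g + 2))"]])
             (simp only: nn_integral_return_pmf zero_le prod.case, rule bound, simp_all)
      next
        case (Some b)
        show ?thesis unfolding Some option.case
          by (simp only: nn_integral_return_pmf zero_le prod.case) (rule bound, simp_all)
      qed
    qed
    also have "\<dots> = ennreal (r ^ flips c * m) * ennreal (r\<^sup>2 / (2 - r))"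
      using r by (subst nn_integral_cmult) (simp_all only: geometric_moment, simp_all)
    also have "\<dots> = ennreal (r ^ flips c * (r\<^sup>2 / (2 - r) * m))"
      using r m0 by (simp add: ennreal_mult'[symmetric] ac_simps)
    also have "\<dots> \<le> ennreal (r ^ flips c * w (view c))"
      using r m0 qm by (intro ennreal_leI mult_left_mono order_trans[OF mult_right_mono qm]) auto
    finally show ?thesis .
  next
    case (Flip l0 l1)
    define a b where "a = w (succ_state i False (view c))" and "b = w (succ_state i True (view c))"
    have ab: "0 \<le> a" "0 \<le> b" by (simp_all add: a_def b_def w0)
    have "r * ((a + b) / 2) \<le> q * ((a + b) / 2)" using rq ab by (intro mult_right_mono) auto
    also have "\<dots> \<le> w (view c)"
      using w[of 0] by (simp add: mean_def Flip a_def b_def add_divide_distrib)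
    finally have "r ^ flips c * (r * ((a + b) / 2)) \<le> r ^ flips c * w (view c)"
      using r by (intro mult_left_mono) auto
    moreover have "(\<integral>\<^sup>+c'. ennreal (r ^ flips c' * w (view c')) \<partial>exec \<theta> i c)
        = ennreal (r ^ flips c * (r * ((a + b) / 2)))"
      using r
      by (simp add: Flip branch_def goto_def view_def a_def b_def w0 nn_integral_bernoulli_ennreal
          algebra_simps add_divide_distrib del: nn_integral_bernoulli_pmf)
    ultimately show ?thesis by (simp add: ennreal_leI)
  next
    case (Input l0 l1)
    define a b where "a = w (succ_state i False (view c))" and "b = w (succ_state i True (view c))"
    have ab: "0 \<le> a" "0 \<le> b" by (simp_all add: a_def b_def w0)
    have "(1 - \<theta>) * a + \<theta> * b \<le> w (view c)"
      using w[of 0] by (simp add: mean_def Input a_def b_def)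
    then have "r ^ flips c * ((1 - \<theta>) * a + \<theta> * b) \<le> r ^ flips c * w (view c)"
      using r by (intro mult_left_mono) auto
    moreover have "(\<integral>\<^sup>+c'. ennreal (r ^ flips c' * w (view c')) \<partial>exec \<theta> i c)
        = ennreal (r ^ flips c * ((1 - \<theta>) * a + \<theta> * b))"
      using r \<theta>
      by (simp add: Input branch_def goto_def view_def a_def b_def w0 nn_integral_bernoulli_ennreal
          algebra_simps del: nn_integral_bernoulli_pmf)
    ultimately show ?thesis by (simp add: ennreal_leI)
  qed
qed

section \<open>Certificates for strong realizability\<close>

text \<open>
  Local conditions, one instruction at a time, from which strong realization follows. The predicate \<open>I\<close> is
  an invariant, \<open>v u\<close> is the probability of output 1 when bag calls have bias \<open>u\<close>, the ranking \<open>R\<close> bounds the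
  expected remaining time, and \<open>w\<close> bounds an exponential moment of the remaining flips.
\<close>

locale certificate =
  fixes M :: machine and \<theta> :: real and I :: "state \<Rightarrow> bool" and v :: "real \<Rightarrow> state \<Rightarrow> real"
    and R w :: "state \<Rightarrow> real" and q :: real
  assumes \<theta>: "0 \<le> \<theta>" "\<theta> < 1"
    and basic: "uses M \<subseteq> basic_resources"
    and start: "I (0, 0, [], [])"
    and closed: "\<And>l h s out b. I (l, h, s, out) \<Longrightarrow> l < length M \<Longrightarrow> possible \<theta> (M ! l) b \<Longrightarrow>
                   I (succ_state (M ! l) b (l, h, s, out))"
    and final_output: "\<And>l h s out. I (l, h, s, out) \<Longrightarrow> length M \<le> l \<Longrightarrow> out = [0] \<or> out = [1]"
    and value_output: "\<And>u l h s out. I (l, h, s, out) \<Longrightarrow> length M \<le> l \<Longrightarrow> v u (l, h, s, out) = of_bool (out = [1])"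
    and value_range: "\<And>u l h s out. I (l, h, s, out) \<Longrightarrow> 0 < u \<Longrightarrow> u < 1 \<Longrightarrow>
                   0 \<le> v u (l, h, s, out) \<and> v u (l, h, s, out) \<le> 1"
    and value_mean: "\<And>u l h s out. I (l, h, s, out) \<Longrightarrow> l < length M \<Longrightarrow> 0 < u \<Longrightarrow> u < 1 \<Longrightarrow>
                   mean u \<theta> (M ! l) (v u) (l, h, s, out) = v u (l, h, s, out)"
    and value_measurable: "\<And>z. (\<lambda>u. v u z) \<in> borel_measurable borel"
    and rank_nonneg: "\<And>z. 0 \<le> R z"
    and rank: "\<And>u l h s out. I (l, h, s, out) \<Longrightarrow> l < length M \<Longrightarrow> 0 < u \<Longrightarrow> u < 1 \<Longrightarrow>
                   1 + mean u \<theta> (M ! l) R (l, h, s, out) \<le> R (l, h, s, out)"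
    and q: "1 < q"
    and weight_ge_1: "\<And>z. 1 \<le> w z"
    and weight: "\<And>u l h s out. I (l, h, s, out) \<Longrightarrow> l < length M \<Longrightarrow> 0 \<le> u \<Longrightarrow> u \<le> 1 \<Longrightarrow>
                   flip_cost q (M ! l) * mean u \<theta> (M ! l) w (l, h, s, out) \<le> w (l, h, s, out)"
begin

definition Inv :: "config \<Rightarrow> bool" where
  "Inv c \<longleftrightarrow> I (view c) \<and> sound c"

lemma Inv_initial: "Inv initial"
  using start by (simp add: Inv_def sound_def initial_def view_def cylinder_empty)

lemma resources_nth: "\<not> halted M c \<Longrightarrow> resources (M ! pc c) \<subseteq> basic_resources"
  using basic by (force simp: uses_def halted_def not_le in_set_conv_nth)

lemma sound_upd:
  assumes "sound c" "bags c 0 (Suc g) = None"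
  shows "emeasure lborel (cylinder ((bags c 0)(Suc g := Some b))) \<noteq> 0"
  using assms by (simp add: sound_def emeasure_cylinder_upd ennreal_divide_eq_0_iff)

lemma set_exec:
  assumes i: "resources i \<subseteq> basic_resources" and c': "c' \<in> set_pmf (exec \<theta> i c)" and c: "sound c"
  shows "sound c' \<and> (\<exists>b. possible \<theta> i b \<and> view c' = succ_state i b (view c))"
  using i
proof (cases rule: exec_cases[where i = i and \<theta> = \<theta> and c = c])
  case (CallBag l0 l1)
  then obtain b c'' where bc: "(b, c'') \<in> set_pmf (call_bag 0 c)" and eq: "c' = branch l0 l1 b c''"
    using c' by auto
  then obtain g n m where "(b, c'') \<in> set_pmf (case bags c 0 (Suc g) of
        Some b \<Rightarrow> return_pmf (b, c\<lparr>flips := n\<rparr>)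
      | None \<Rightarrow> coin \<bind> (\<lambda>b. return_pmf (b, c\<lparr>flips := n,
            bags := (bags c)(0 := (bags c 0)(Suc g := Some b)), flips := m\<rparr>)))"
    unfolding call_bag_def Let_def set_bind_pmf plus_1_eq_Suc by blast
  then have "view c'' = view c \<and> sound c''"
    using c sound_upd[OF c] by (auto simp: sound_def split: option.splits)
  moreover have "view c' = succ_state i b (view c)" if "view c'' = view c"
    using that by (auto simp: eq CallBag view_def branch_def goto_def)
  moreover have "possible \<theta> i b" by (simp add: CallBag possible_def)
  moreover have "sound c' = sound c''" by (simp add: eq sound_def branch_def goto_def)
  ultimately show ?thesis by blast
next
  case (Flip l0 l1)
  then obtain b where eq: "c' = branch l0 l1 b (c\<lparr>flips := flips c + 1\<rparr>)"
    using c' by auto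
  have "view c' = succ_state i b (view c)" "possible \<theta> i b" "sound c' = sound c"
    by (simp_all add: eq Flip possible_def sound_def view_def branch_def goto_def)
  then show ?thesis using c by blast
next
  case (Input l0 l1)
  then obtain b where b: "b \<in> set_pmf (bernoulli_pmf \<theta>)" and eq: "c' = branch l0 l1 b c"
    using c' by auto
  have "b \<longrightarrow> 0 < \<theta>" using b \<theta> by (cases b) (auto simp: set_pmf_iff)
  then have "view c' = succ_state i b (view c)" "possible \<theta> i b" "sound c' = sound c"
    by (simp_all add: eq Input possible_def sound_def view_def branch_def goto_def)
  then show ?thesis using c by blast
next
  case (det c'')
  then show ?thesis using c' c by (auto simp: possible_def sound_def intro!: exI[of _ False])
qed

lemma Inv_exec:
  assumes "Inv c" "\<not> halted M c" "c' \<in> set_pmf (exec \<theta> (M ! pc c) c)"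
  shows "Inv c'"
  using set_exec[OF resources_nth[OF assms(2)] assms(3)] assms closed
  by (auto simp: Inv_def halted_def view_def)

text \<open>
  As \<open>u = 0\<close> is a null event, the conditions on certificates may assume \<open>u > 0\<close>.
\<close>

lemma lift_mono:
  assumes "\<And>u. 0 < u \<Longrightarrow> u < 1 \<Longrightarrow> f u (view c) \<le> g u (view c)"
  shows "lift f c \<le> lift g c"
proof -
  have "AE u in lborel. u \<noteq> (0::real)" by (rule AE_lborel_singleton)
  then have "(\<integral>\<^sup>+u\<in>cylinder (bags c 0). f u (view c) \<partial>lborel) \<le> (\<integral>\<^sup>+u\<in>cylinder (bags c 0). g u (view c) \<partial>lborel)"
    by (intro nn_integral_mono_AE, eventually_elim) (auto simp: cylinder_def indicator_def intro!: assms)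
  then show ?thesis by (simp add: lift_def divide_right_mono_ennreal)
qed

lemma lift_const:
  assumes "sound c"
  shows "lift (\<lambda>_. f) c = f (view c)"
proof -
  have "emeasure lborel (cylinder (bags c 0)) \<noteq> \<top>"
    using emeasure_cylinder_le[of "bags c 0"] by (auto simp: top_unique)
  then show ?thesis using assms
    by (simp add: lift_def sound_def nn_integral_cmult_indicator ennreal_times_divide[symmetric]
        ennreal_divide_self top.not_eq_extremum)
qed

lemma bias_range:
  assumes "0 \<le> u" "u \<le> 1"
  shows "0 \<le> bias u \<theta> i" "bias u \<theta> i \<le> 1"
  using assms \<theta> by (cases i; simp)+

lemma nn_mean_ennreal:
  assumes u: "0 \<le> u" "u \<le> 1" and f: "\<And>b. possible \<theta> i b \<Longrightarrow> 0 \<le> f (succ_state i b z)"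
  shows "nn_mean u \<theta> i (\<lambda>z. ennreal (f z)) z = ennreal (mean u \<theta> i f z)"
proof -
  note range = bias_range[OF u, of i]
  have F: "0 \<le> f (succ_state i False z)" using f[of False] by (simp add: possible_def)
  show ?thesis
  proof (cases "bias u \<theta> i = 0")
    case True
    then show ?thesis by (simp add: nn_mean_def mean_def)
  next
    case False
    then have "possible \<theta> i True" using range by (cases i) (auto simp: possible_def)
    from f[OF this] F range show ?thesis
      by (simp add: nn_mean_def mean_def ennreal_mult' ennreal_plus)
  qed
qed

lemma exec_lift_le:
  assumes f: "\<And>z. (\<lambda>u. f u z) \<in> borel_measurable borel"
    and range: "\<And>u z. I z \<Longrightarrow> 0 < u \<Longrightarrow> u < 1 \<Longrightarrow> 0 \<le> f u z"
    and super: "\<And>u l h s out. I (l, h, s, out) \<Longrightarrow> l < length M \<Longrightarrow> 0 < u \<Longrightarrow> u < 1 \<Longrightarrow>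
                   mean u \<theta> (M ! l) (f u) (l, h, s, out) \<le> g u (l, h, s, out)"
    and c: "Inv c" "\<not> halted M c"
  shows "(\<integral>\<^sup>+c'. lift (\<lambda>u z. ennreal (f u z)) c' \<partial>exec \<theta> (M ! pc c) c) \<le> lift (\<lambda>u z. ennreal (g u z)) c"
proof -
  have l: "pc c < length M" using c by (simp add: halted_def)
  have I: "I (view c)" using c by (simp add: Inv_def)
  have "(\<integral>\<^sup>+c'. lift (\<lambda>u z. ennreal (f u z)) c' \<partial>exec \<theta> (M ! pc c) c)
      = lift (\<lambda>u. nn_mean u \<theta> (M ! pc c) (\<lambda>z. ennreal (f u z))) c"
    using f \<theta> by (intro nn_integral_exec_lift resources_nth c) auto
  also have "\<dots> \<le> lift (\<lambda>u z. ennreal (g u z)) c"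
  proof (rule lift_mono)
    fix u :: real assume u: "0 < u" "u < 1"
    have "nn_mean u \<theta> (M ! pc c) (\<lambda>z. ennreal (f u z)) (view c) = ennreal (mean u \<theta> (M ! pc c) (f u) (view c))"
      using u I l by (intro nn_mean_ennreal range) (auto simp: view_def intro: closed)
    also have "\<dots> \<le> ennreal (g u (view c))"
      using I l u by (intro ennreal_leI) (auto simp: view_def intro: super)
    finally show "nn_mean u \<theta> (M ! pc c) (\<lambda>z. ennreal (f u z)) (view c) \<le> ennreal (g u (view c))" .
  qed
  finally show ?thesis .
qed

lemma exec_rank:
  assumes c: "Inv c" "\<not> halted M c"
  shows "1 + (\<integral>\<^sup>+c'. lift (\<lambda>_ z. ennreal (R z)) c' \<partial>exec \<theta> (M ! pc c) c) \<le> lift (\<lambda>_ z. ennreal (R z)) c"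
proof -
  have l: "pc c < length M" using c by (simp add: halted_def)
  have I: "I (view c)" using c by (simp add: Inv_def)
  have "1 + mean (1/2) \<theta> (M ! pc c) R (view c) \<le> R (view c)"
    using I l by (auto simp: view_def intro: rank)
  moreover have "0 \<le> mean (1/2) \<theta> (M ! pc c) R (view c)"
    using bias_range[of "1/2"] rank_nonneg by (simp add: mean_def)
  ultimately have R1: "1 \<le> R (view c)" by simp
  have "1 + (\<integral>\<^sup>+c'. lift (\<lambda>_ z. ennreal (R z)) c' \<partial>exec \<theta> (M ! pc c) c) \<le> 1 + lift (\<lambda>_ z. ennreal (R z - 1)) c"
  proof (intro add_left_mono exec_lift_le c)
    fix u :: real and l h s out assume "I (l, h, s, out)" "l < length M" "0 < u" "u < 1"
    from rank[OF this] show "mean u \<theta> (M ! l) R (l, h, s, out) \<le> R (l, h, s, out) - 1" by simp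
  qed (simp_all add: rank_nonneg)
  also have "\<dots> = ennreal 1 + ennreal (R (view c) - 1)"
    using c by (simp add: lift_const Inv_def)
  also have "\<dots> = ennreal (1 + (R (view c) - 1))"
    using R1 by (intro ennreal_plus[symmetric]) auto
  also have "\<dots> = lift (\<lambda>_ z. ennreal (R z)) c"
    using c by (simp add: lift_const Inv_def)
  finally show ?thesis .
qed

lemma rank_finite: "Inv c \<Longrightarrow> lift (\<lambda>_ z. ennreal (R z)) c < \<top>"
  by (simp add: lift_const Inv_def)

lemma emeasure_execution_le:
  assumes f: "\<And>z. (\<lambda>u. f u z) \<in> borel_measurable borel"
    and range: "\<And>u z. I z \<Longrightarrow> 0 < u \<Longrightarrow> u < 1 \<Longrightarrow> 0 \<le> f u z"
    and super: "\<And>u l h s out. I (l, h, s, out) \<Longrightarrow> l < length M \<Longrightarrow> 0 < u \<Longrightarrow> u < 1 \<Longrightarrow>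
                   mean u \<theta> (M ! l) (f u) (l, h, s, out) \<le> f u (l, h, s, out)"
    and final: "\<And>c u. I (view c) \<Longrightarrow> halted M c \<Longrightarrow> Some c \<in> X \<Longrightarrow> 1 \<le> f u (view c)"
  shows "emeasure (measure_pmf (execution M \<theta>)) X \<le> (\<integral>\<^sup>+u\<in>{0..<1}. ennreal (f u (0, 0, [], [])) \<partial>lborel)"
proof -
  have "emeasure (measure_pmf (execution M \<theta>)) X \<le> lift (\<lambda>u z. ennreal (f u z)) initial"
    unfolding execution_def
  proof (rule run_le_superharmonic[where Inv = Inv])
    fix c assume c: "Inv c" "halted M c" "Some c \<in> X"
    have "1 = lift (\<lambda>_ _. 1) c" using c by (simp add: lift_const Inv_def)
    also have "\<dots> \<le> lift (\<lambda>u z. ennreal (f u z)) c"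
    proof (rule lift_mono)
      fix u :: real
      have "1 \<le> f u (view c)" using c by (intro final) (auto simp: Inv_def)
      then show "1 \<le> ennreal (f u (view c))" by (metis ennreal_1 ennreal_leI)
    qed
    finally show "1 \<le> lift (\<lambda>u z. ennreal (f u z)) c" .
  next
    show "(\<integral>\<^sup>+c'. lift (\<lambda>u z. ennreal (f u z)) c' \<partial>exec \<theta> (M ! pc c) c) \<le> lift (\<lambda>u z. ennreal (f u z)) c"
      if "Inv c" "\<not> halted M c" for c
      using f range super that by (rule exec_lift_le)
  qed (fact Inv_exec exec_rank rank_finite[OF Inv_initial] Inv_initial)+
  also have "\<dots> = (\<integral>\<^sup>+u\<in>{0..<1}. ennreal (f u (0, 0, [], [])) \<partial>lborel)"
    by (simp add: lift_def initial_def view_def cylinder_empty divide_ennreal_def)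
  finally show ?thesis .
qed

text \<open>
  \<open>v\<close>, \<open>1 - v\<close> and 0 are superharmonic, and bound the probabilities of output 1, of output 0 and
  of any other outcome, including divergence. The integrals of the first two add up to 1.
\<close>

lemma output_law:
  assumes p: "((\<lambda>u. v u (0, 0, [], [])) has_integral p) {0..1}"
  shows "p \<in> {0..1}"
    and "map_spmf out_queue (execution M \<theta>) = spmf_of_pmf (map_pmf (\<lambda>b. [of_bool b]) (bernoulli_pmf p))"
proof -
  let ?v = "\<lambda>u. v u (0, 0, [], [])"
  have range: "0 \<le> ?v u \<and> ?v u \<le> 1" if "u \<in> {0<..<1}" for u
    using value_range[OF start] that by auto
  have int: "(f has_integral x) {0<..<1} \<longleftrightarrow> (f has_integral x) {0..1}" for f :: "real \<Rightarrow> real" and x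
    by (simp add: has_integral_Icc_iff_Ioo)
  have p': "((\<lambda>u. 1 - ?v u) has_integral (1 - p)) {0..1}"
    using has_integral_diff[OF has_integral_const_real[of "1::real" 0 1] p] by simp
  have p0: "0 \<le> p" using p range by (intro has_integral_nonneg[of ?v p "{0<..<1}"]) (auto simp: int)
  have p1: "p \<le> 1" using p' range has_integral_nonneg[of "\<lambda>u. 1 - ?v u" "1 - p" "{0<..<1}"] by (auto simp: int)
  show "p \<in> {0..1}" using p0 p1 by simp
  have integral: "(\<integral>\<^sup>+u\<in>{0..<1}. ennreal (f u) \<partial>lborel) = ennreal x"
    if f: "(f has_integral x) {0..1}" and f0: "\<And>u. u \<in> {0<..<1} \<Longrightarrow> 0 \<le> f u" for f :: "real \<Rightarrow> real" and x
  proof -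
    have "AE u in lborel. u \<noteq> (0::real)" by (rule AE_lborel_singleton)
    then have "(\<integral>\<^sup>+u\<in>{0..<1}. ennreal (f u) \<partial>lborel) = (\<integral>\<^sup>+u\<in>{0<..<1}. ennreal (f u) \<partial>lborel)"
      by (intro nn_integral_cong_AE, eventually_elim) (auto simp: indicator_def)
    also have "\<dots> = ennreal x"
      using f f0 by (intro nn_integral_has_integral_lebesgue') (auto simp: int)
    finally show ?thesis .
  qed
  let ?q = "spmf_of_pmf (map_pmf (\<lambda>b. [of_bool b :: nat]) (bernoulli_pmf p))"
  show "map_spmf out_queue (execution M \<theta>) = ?q"
  proof (rule pmf_eqI_le)
    fix y :: "nat list option"
    define X :: "config option set" where "X = map_option out_queue -` {y}"
    have pmf: "ennreal (pmf (map_spmf out_queue (execution M \<theta>)) y) = emeasure (measure_pmf (execution M \<theta>)) X"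
      by (simp add: X_def pmf_map measure_pmf.emeasure_eq_measure)
    have q: "pmf ?q y = (if y = Some [1] then p else if y = Some [0] then 1 - p else 0)"
    proof -
      have "?q = map_pmf (\<lambda>b. Some [of_bool b]) (bernoulli_pmf p)"
        by (simp add: spmf_of_pmf_def pmf.map_comp o_def)
      then have "pmf ?q y = measure (bernoulli_pmf p) ((\<lambda>b. Some [of_bool b]) -` {y})"
        by (simp add: pmf_map)
      moreover have "(\<lambda>b. Some [of_bool b :: nat]) -` {y}
          = (if y = Some [1] then {True} else if y = Some [0] then {False} else {})"
      proof (intro set_eqI)
        fix b
        show "b \<in> (\<lambda>b. Some [of_bool b :: nat]) -` {y}
            \<longleftrightarrow> b \<in> (if y = Some [1] then {True} else if y = Some [0] then {False} else {})"
          by (cases b) (auto split: if_splits)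
      qed
      ultimately show ?thesis using p0 p1 by (simp add: measure_pmf_single)
    qed
    have "emeasure (measure_pmf (execution M \<theta>)) X \<le> ennreal (pmf ?q y)"
    proof -
      have mean_diff: "mean u \<theta> i (\<lambda>z. 1 - f z) z = 1 - mean u \<theta> i f z" for u i f z
        by (simp add: mean_def algebra_simps)
      consider "y = Some [1]" | "y = Some [0]" | "y \<noteq> Some [1]" "y \<noteq> Some [0]" by blast
      then show ?thesis
      proof cases
        case 1
        have "emeasure (measure_pmf (execution M \<theta>)) X \<le> (\<integral>\<^sup>+u\<in>{0..<1}. ennreal (?v u) \<partial>lborel)"
        proof (rule emeasure_execution_le)
          show "1 \<le> v u (view c)" if "I (view c)" "halted M c" "Some c \<in> X" for u c
            using that by (simp add: view_def halted_def value_output X_def 1)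
        qed (simp_all add: value_measurable value_mean, metis value_range prod_cases4)
        then show ?thesis unfolding q using 1 integral[OF p] range by simp
      next
        case 2
        have "emeasure (measure_pmf (execution M \<theta>)) X \<le> (\<integral>\<^sup>+u\<in>{0..<1}. ennreal (1 - ?v u) \<partial>lborel)"
        proof (rule emeasure_execution_le)
          show "1 \<le> 1 - v u (view c)" if "I (view c)" "halted M c" "Some c \<in> X" for u c
            using that by (simp add: view_def halted_def value_output X_def 2)
        next
          show "(\<lambda>u. 1 - v u z) \<in> borel_measurable borel" for z
            using value_measurable[of z] by measurable
        next
          show "0 \<le> 1 - v u z" if "I z" "0 < u" "u < 1" for u z
            using that value_range by (metis diff_ge_0_iff_ge prod_cases4)
        qed (simp_all add: value_mean mean_diff)
        then show ?thesis unfolding q using 2 integral[OF p'] range by simp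
      next
        case 3
        have "emeasure (measure_pmf (execution M \<theta>)) X \<le> (\<integral>\<^sup>+u\<in>{0..<1::real}. ennreal 0 \<partial>lborel)"
        proof (rule emeasure_execution_le[where f = "\<lambda>_ _. 0"])
          show "(1::real) \<le> 0" if c: "I (view c)" "halted M c" "Some c \<in> X" for c
            using c 3 final_output[of "pc c"] by (auto simp: view_def halted_def X_def)
        qed (simp_all add: mean_def)
        then show ?thesis by simp
      qed
    qed
    then show "pmf (map_spmf out_queue (execution M \<theta>)) y \<le> pmf ?q y"
      by (simp only: pmf[symmetric] ennreal_le_iff pmf_nonneg)
  qed
qed

text \<open>
  Markov's inequality for the supermartingale that multiplies the weight by \<open>r\<close> to the number of flips.
\<close>

lemma exponential_tails: "exponential_tails M \<theta>"
proof -
  \<comment> \<open>A bag call costs at most the factor \<open>r\<^sup>2 / (2 - r)\<close>, which at \<open>r = 1 + e\<close> is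
    at most \<open>1 + 10 e\<close> for \<open>e \<le> 1/2\<close>.\<close>
  define r where "r = min (3/2) (1 + (q - 1) / 10)"
  have r: "1 < r" "r < 2" using q by (auto simp: r_def)
  have "r\<^sup>2 \<le> q * (2 - r)"
  proof -
    define e where "e = r - 1"
    have e: "0 < e" "e \<le> 1/2" "1 + 10 * e \<le> q" using q by (auto simp: e_def r_def min_def field_simps)
    have "e * e \<le> e * (1/2)" using e by (intro mult_left_mono) auto
    then have "(1 + e)\<^sup>2 \<le> (1 + 10 * e) * (1 - e)" using e by (simp add: power2_eq_square algebra_simps)
    also have "\<dots> \<le> q * (1 - e)" using e by (intro mult_right_mono) auto
    finally show ?thesis by (simp add: e_def)
  qed
  then have rq: "r\<^sup>2 / (2 - r) \<le> q" using r by (simp add: divide_le_eq)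
  have w0: "0 \<le> w z" for z using weight_ge_1[of z] by simp
  have tail: "emeasure (measure_pmf (execution M \<theta>)) (Some ` {c. flips c > m}) \<le> ennreal (w (0, 0, [], []) * (1 / r) ^ m)" for m
  proof -
    have "emeasure (measure_pmf (execution M \<theta>)) (Some ` {c. flips c > m})
        \<le> ennreal ((1 / r) ^ m) * ennreal (r ^ flips initial * w (view initial))"
      unfolding execution_def
    proof (rule run_le_superharmonic[where Inv = Inv])
      fix c assume c: "Inv c" "\<not> halted M c"
      have "(\<integral>\<^sup>+c'. ennreal (r ^ flips c' * w (view c')) \<partial>exec \<theta> (M ! pc c) c) \<le> ennreal (r ^ flips c * w (view c))"
        using c \<theta> r rq w0 weight
        by (intro nn_integral_exec_flips[where q = q] resources_nth) (auto simp: Inv_def halted_def view_def)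
      then show "(\<integral>\<^sup>+c'. ennreal ((1 / r) ^ m) * ennreal (r ^ flips c' * w (view c')) \<partial>exec \<theta> (M ! pc c) c)
          \<le> ennreal ((1 / r) ^ m) * ennreal (r ^ flips c * w (view c))"
        by (subst nn_integral_cmult) (auto intro: mult_left_mono)
    next
      fix c assume "Inv c" "halted M c" "Some c \<in> Some ` {c. flips c > m}"
      then have "r ^ m * 1 \<le> r ^ flips c * w (view c)"
        using r weight_ge_1 by (intro mult_mono power_increasing) auto
      then have "1 \<le> (1 / r) ^ m * (r ^ flips c * w (view c))"
        using r by (simp add: power_divide field_simps)
      then have "1 \<le> ennreal ((1 / r) ^ m * (r ^ flips c * w (view c)))"
        by (metis ennreal_1 ennreal_leI)
      then show "1 \<le> ennreal ((1 / r) ^ m) * ennreal (r ^ flips c * w (view c))"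
        using r by (simp only: ennreal_mult' zero_le_power zero_le_divide_1_iff)
    qed (fact Inv_exec exec_rank rank_finite[OF Inv_initial] Inv_initial)+
    also have "\<dots> = ennreal (w (0, 0, [], []) * (1 / r) ^ m)"
      using r w0 by (simp add: initial_def view_def ennreal_mult'[symmetric] mult.commute)
    finally show ?thesis .
  qed
  have "measure (measure_spmf (execution M \<theta>)) {c. flips c > m} \<le> w (0, 0, [], []) * (1 / r) ^ m" for m
    using tail[of m] r w0
    by (simp add: measure_measure_spmf_conv_measure_pmf measure_pmf.emeasure_eq_measure)
  then show ?thesis
    unfolding exponential_tails_def using r by (intro exI[of _ "w (0, 0, [], [])"] exI[of _ "1 / r"]) auto
qed

end

theorem strongly_realizesI:
  assumes "\<And>\<theta>. 0 \<le> \<theta> \<Longrightarrow> \<theta> < 1 \<Longrightarrow> \<exists>I v R w q. certificate M \<theta> I v R w q \<and>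
             ((\<lambda>u. v u (0, 0, [], [])) has_integral \<phi> \<theta>) {0..1}"
  shows "strongly_realizes M {0..<1} \<phi>"
  unfolding strongly_realizes_def weakly_realizes_def
proof (intro conjI ballI)
  fix \<theta> :: real assume "\<theta> \<in> {0..<1}"
  then obtain I v R w q where "certificate M \<theta> I v R w q"
    and int: "((\<lambda>u. v u (0, 0, [], [])) has_integral \<phi> \<theta>) {0..1}"
    using assms[of \<theta>] by auto
  then interpret certificate M \<theta> I v R w q by simp
  show "\<phi> \<theta> \<in> {0..1}"
    and "map_spmf out_queue (execution M \<theta>) = spmf_of_pmf (map_pmf (\<lambda>b. [of_bool b]) (bernoulli_pmf (\<phi> \<theta>)))"
    using output_law[OF int] by simp_all
  show "exponential_tails M \<theta>" by (rule exponential_tails)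
qed

section \<open>Logarithm and arc tangent\<close>

text \<open>
  A function on states that depends only on the address inside the program, and only on the output after it.
\<close>

fun table :: "real list \<Rightarrow> (nat list \<Rightarrow> real) \<Rightarrow> state \<Rightarrow> real" where
  "table xs f (l, h, s, out) = (if l < length xs then xs ! l else f out)"

fun clean_output :: "nat \<Rightarrow> state \<Rightarrow> bool" where
  "clean_output n (l, h, s, out) \<longleftrightarrow> (if l < n then out = [] else out = [0] \<or> out = [1])"

text \<open>
  The weight condition of a loop that is left with probability at least \<open>1 - x\<close> per round, with weight 2
  at its entry and cost factor \<open>1 + (1 - x) / 2\<close> per round. The tails get heavier as \<open>x\<close> tends to 1.
\<close>

lemma tail_factor:
  fixes x :: real
  shows "(1 - x) + x * (2 * (1 + (1 - x) / 2)) \<le> 2"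
  using zero_le_power2[of "1 - x"] by (simp add: power2_eq_square field_simps)

text \<open>
  Address 1 is reached after an even and address 3 after an odd number of successful trials; a failure
  emits 1 or 0 accordingly. The first input contributes the factor \<open>x\<close>.
\<close>

definition log_machine :: machine where
  "log_machine = [Input 6 1, Input 5 2, CallBag 0 5 3, Input 6 4, CallBag 0 6 1, Emit 1 7, Emit 0 7]"

text \<open>
  From the even state, with \<open>y = 1 / (1 + x u)\<close>, output 1 has probability \<open>y\<close>, and from the odd state \<open>x u y = 1 - y\<close>.
\<close>

lemma log_certificate:
  fixes x :: real
  assumes x: "0 \<le> x" "x < 1"
  defines "y \<equiv> (\<lambda>u. 1 / (1 + x * u))" and "C \<equiv> 2 / (1 - x)" and "q \<equiv> 1 + (1 - x) / 2"
  shows "certificate log_machine x (clean_output 7)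
           (\<lambda>u. table [x * y u, y u, 1 - u * y u, x * u * y u, u * y u, 1, 0] (\<lambda>out. of_bool (out = [1])))
           (table [C, C, 1 + C, C, 1 + C, 1, 1] (\<lambda>_. 0))
           (table [2, 2, 2 * q, 2, 2 * q, 1, 1] (\<lambda>_. 1)) q"
    (is "certificate _ _ _ ?v ?R ?w _")
proof -
  have C: "2 + x * C = C" "1 \<le> C" using x by (simp_all add: C_def field_simps)
  have q: "1 < q" "(1 - x) + x * (2 * q) \<le> 2" using x tail_factor[of x] by (simp_all add: q_def)
  have y: "y u * (1 + x * u) = 1" "0 \<le> y u" "y u \<le> 1" if "0 \<le> u" for u
  proof -
    have "1 \<le> 1 + x * u" using that x by simp
    then show "y u * (1 + x * u) = 1" "0 \<le> y u" "y u \<le> 1" by (simp_all add: y_def)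
  qed
  have prods: "0 \<le> a * b" "a * b \<le> 1" if "0 \<le> a" "a \<le> 1" "0 \<le> b" "b \<le> 1" for a b :: real
    using that by (simp_all add: mult_le_one)
  have len: "length log_machine = 7" by (simp add: log_machine_def)
  have pcs: "l = 0 \<or> l = 1 \<or> l = 2 \<or> l = 3 \<or> l = 4 \<or> l = 5 \<or> l = 6" if "l < 7" for l :: nat
    using that by auto
  show ?thesis
  proof (unfold_locales, unfold len)
    show "uses log_machine \<subseteq> basic_resources" by (simp add: uses_def log_machine_def)
    show "clean_output 7 (succ_state (log_machine ! l) b (l, h, s, out))"
      if "clean_output 7 (l, h, s, out)" "l < 7" for l h s out b
      using pcs[OF that(2)] that(1) by (elim disjE) (simp_all add: log_machine_def)
    show "0 \<le> ?v u (l, h, s, out) \<and> ?v u (l, h, s, out) \<le> 1" if "0 < u" "u < 1" for u l h s out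
    proof (cases "l < 7")
      case True
      show ?thesis using pcs[OF True] y[of u] that x prods
        by (elim disjE) (simp_all add: mult.assoc)
    qed simp
    show "mean u x (log_machine ! l) (?v u) (l, h, s, out) = ?v u (l, h, s, out)"
      if "clean_output 7 (l, h, s, out)" "l < 7" "0 < u" "u < 1" for u l h s out
    proof -
      have xuy: "x * (u * y u) = 1 - y u"
        using y(1)[of u] that by (simp add: algebra_simps)
      then have "u * (x * u * y u) = u - u * y u"
        by (simp add: mult.assoc right_diff_distrib)
      with xuy show ?thesis using pcs[OF that(2)] that(1)
        by (elim disjE) (simp_all add: log_machine_def mean_def right_diff_distrib)
    qed
    show "1 + mean u x (log_machine ! l) ?R (l, h, s, out) \<le> ?R (l, h, s, out)"
      if "clean_output 7 (l, h, s, out)" "l < 7" "0 < u" "u < 1" for u l h s out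
    proof -
      have "(1 - u) * 1 + u * C \<le> (1 - u) * C + u * C"
        using that C by (intro add_mono mult_left_mono) auto
      then show ?thesis using pcs[OF that(2)] that(1) C x
        by (elim disjE; simp add: log_machine_def mean_def algebra_simps)
    qed
    show "flip_cost q (log_machine ! l) * mean u x (log_machine ! l) ?w (l, h, s, out) \<le> ?w (l, h, s, out)"
      if "clean_output 7 (l, h, s, out)" "l < 7" "0 \<le> u" "u \<le> 1" for u l h s out
    proof -
      have "q * ((1 - u) * 1 + u * 2) \<le> q * 2"
        using that q by (intro mult_left_mono) auto
      then show ?thesis using pcs[OF that(2)] that(1) q x
        by (elim disjE; simp add: log_machine_def mean_def algebra_simps)
    qed
    fix z :: state
    obtain l h s out where z: "z = (l, h, s, out)" by (cases z)
    have "(\<lambda>u. ?v u z) \<in> borel_measurable borel \<and> 0 \<le> ?R z \<and> 1 \<le> ?w z"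
    proof (cases "l < 7")
      case True
      show ?thesis using pcs[OF True] C q unfolding z by (elim disjE) (simp_all add: y_def)
    qed (simp add: z)
    then show "(\<lambda>u. ?v u z) \<in> borel_measurable borel" "0 \<le> ?R z" "1 \<le> ?w z" by auto
  qed (use x q in \<open>auto simp: len split: if_splits\<close>)
qed

lemma log_integral:
  fixes x :: real
  assumes x: "0 \<le> x" "x < 1"
  shows "((\<lambda>u. x * (1 / (1 + x * u))) has_integral ln (1 + x)) {0..1}"
proof -
  have "((\<lambda>u. x * (1 / (1 + x * u))) has_integral (ln (1 + x * 1) - ln (1 + x * 0))) {0..1}"
    using x
    by (intro fundamental_theorem_of_calculus)
      (auto intro!: derivative_eq_intros simp: add_pos_nonneg simp flip: has_real_derivative_iff_has_vector_derivative)
  then show ?thesis by simp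
qed

text \<open>
  The loop of the logarithm with twice as many inputs and bag calls per trial, so that a trial
  succeeds with probability \<open>(x u)\<^sup>2\<close>.
\<close>

definition arctan_machine :: machine where
  "arctan_machine = [Input 10 1, Input 9 2, CallBag 0 9 3, Input 9 4, CallBag 0 9 5,
     Input 10 6, CallBag 0 10 7, Input 10 8, CallBag 0 10 1, Emit 1 11, Emit 0 11]"

lemma arctan_certificate:
  fixes x :: real
  assumes x: "0 \<le> x" "x < 1"
  defines "y \<equiv> (\<lambda>u. 1 / (1 + (x * u)\<^sup>2))" and "C \<equiv> 4 / (1 - x)" and "q \<equiv> 1 + (1 - x) / 2"
  shows "certificate arctan_machine x (clean_output 11)
           (\<lambda>u. table [x * y u, y u, 1 - x * u * u * y u, 1 - x * u * y u, 1 - u * y u,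
                  x * x * u * u * y u, x * u * u * y u, x * u * y u, u * y u, 1, 0] (\<lambda>out. of_bool (out = [1])))
           (table [C, C, 3 + C, 2 + C, 1 + C, C, 3 + C, 2 + C, 1 + C, 1, 1] (\<lambda>_. 0))
           (table [2, 2, 2 * q, 2, 2 * q, 2, 2 * q, 2, 2 * q, 1, 1] (\<lambda>_. 1)) q"
    (is "certificate _ _ _ ?v ?R ?w _")
proof -
  have C: "4 + x * C = C" "1 \<le> C" using x by (simp_all add: C_def field_simps)
  have q: "1 < q" "(1 - x) + x * (2 * q) \<le> 2" using x tail_factor[of x] by (simp_all add: q_def)
  have y: "y u * (1 + x * x * u * u) = 1" "0 \<le> y u" "y u \<le> 1" for u
  proof -
    have "1 \<le> 1 + (x * u)\<^sup>2" by simp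
    moreover define d where "d = 1 + (x * u)\<^sup>2"
    ultimately have "1 \<le> d" "y u = 1 / d" by (simp_all add: y_def)
    then have "y u * (1 + (x * u)\<^sup>2) = 1" "0 \<le> y u" "y u \<le> 1" by (simp_all add: d_def[symmetric])
    then show "y u * (1 + x * x * u * u) = 1" "0 \<le> y u" "y u \<le> 1"
      by (simp_all add: power2_eq_square ac_simps)
  qed
  have prods: "0 \<le> a * b" "a * b \<le> 1" if "0 \<le> a" "a \<le> 1" "0 \<le> b" "b \<le> 1" for a b :: real
    using that by (simp_all add: mult_le_one)
  have len: "length arctan_machine = 11" by (simp add: arctan_machine_def)
  have pcs: "l = 0 \<or> l = 1 \<or> l = 2 \<or> l = 3 \<or> l = 4 \<or> l = 5 \<or> l = 6 \<or> l = 7 \<or> l = 8 \<or> l = 9 \<or> l = 10"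
    if "l < 11" for l :: nat
    using that by presburger
  show ?thesis
  proof (unfold_locales, unfold len)
    show "uses arctan_machine \<subseteq> basic_resources" by (simp add: uses_def arctan_machine_def)
    show "clean_output 11 (succ_state (arctan_machine ! l) b (l, h, s, out))"
      if "clean_output 11 (l, h, s, out)" "l < 11" for l h s out b
      using pcs[OF that(2)] that(1) by (elim disjE) (simp_all add: arctan_machine_def)
    show "0 \<le> ?v u (l, h, s, out) \<and> ?v u (l, h, s, out) \<le> 1" if "0 < u" "u < 1" for u l h s out
    proof (cases "l < 11")
      case True
      show ?thesis using pcs[OF True] y[of u] that x prods
        by (elim disjE) (simp_all add: mult.assoc)
    qed simp
    show "mean u x (arctan_machine ! l) (?v u) (l, h, s, out) = ?v u (l, h, s, out)"
      if "clean_output 11 (l, h, s, out)" "l < 11" "0 < u" "u < 1" for u l h s out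
    proof -
      have xuy: "x * (x * u * u * y u) = 1 - y u"
        using y(1)[of u] that by (simp add: algebra_simps)
      then have "u * (x * x * u * u * y u) = u - u * y u"
        by (simp add: mult.assoc right_diff_distrib)
      with xuy show ?thesis using pcs[OF that(2)] that(1)
        by (elim disjE) (simp_all add: arctan_machine_def mean_def right_diff_distrib)
    qed
    show "1 + mean u x (arctan_machine ! l) ?R (l, h, s, out) \<le> ?R (l, h, s, out)"
      if "clean_output 11 (l, h, s, out)" "l < 11" "0 < u" "u < 1" for u l h s out
    proof -
      have "(1 - u) * 1 + u * C \<le> (1 - u) * C + u * C"
        using that C by (intro add_mono mult_left_mono) auto
      then show ?thesis using pcs[OF that(2)] that C x
        by (elim disjE; simp add: arctan_machine_def mean_def algebra_simps)
    qed
    show "flip_cost q (arctan_machine ! l) * mean u x (arctan_machine ! l) ?w (l, h, s, out) \<le> ?w (l, h, s, out)"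
      if "clean_output 11 (l, h, s, out)" "l < 11" "0 \<le> u" "u \<le> 1" for u l h s out
    proof -
      have "q * ((1 - u) * 1 + u * 2) \<le> q * 2"
        using that q by (intro mult_left_mono) auto
      then show ?thesis using pcs[OF that(2)] that(1) q x
        by (elim disjE; simp add: arctan_machine_def mean_def algebra_simps)
    qed
    fix z :: state
    obtain l h s out where z: "z = (l, h, s, out)" by (cases z)
    have "(\<lambda>u. ?v u z) \<in> borel_measurable borel \<and> 0 \<le> ?R z \<and> 1 \<le> ?w z"
    proof (cases "l < 11")
      case True
      show ?thesis using pcs[OF True] C q unfolding z by (elim disjE) (simp_all add: y_def)
    qed (simp add: z)
    then show "(\<lambda>u. ?v u z) \<in> borel_measurable borel" "0 \<le> ?R z" "1 \<le> ?w z" by auto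
  qed (use x q in \<open>auto simp: len split: if_splits\<close>)
qed

lemma arctan_integral:
  fixes x :: real
  shows "((\<lambda>u. x * (1 / (1 + (x * u)\<^sup>2))) has_integral arctan x) {0..1}"
proof -
  have "((\<lambda>u. x * (1 / (1 + (x * u)\<^sup>2))) has_integral (arctan (x * 1) - arctan (x * 0))) {0..1}"
    by (intro fundamental_theorem_of_calculus)
      (auto intro!: derivative_eq_intros simp: inverse_eq_divide simp flip: has_real_derivative_iff_has_vector_derivative)
  then show ?thesis by simp
qed

section \<open>Arc sine\<close>

text \<open>
  The probability that a fair walk killed with probability \<open>1 - t\<close> before each step reaches the level below
  its start: the root \<open>(1 - sqrt (1 - t\<^sup>2)) / t\<close> of \<open>g = t (1 + g\<^sup>2) / 2\<close>, written so as to make sense at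
  \<open>t = 0\<close>.
\<close>

definition first_passage :: "real \<Rightarrow> real" where
  "first_passage t = t / (1 + sqrt (1 - t\<^sup>2))"

text \<open>
  The first claim is a first step analysis: down, or up and then down twice. The second makes
  \<open>t * first_passage t\<close> the generating function \<open>1 - sqrt (1 - t\<^sup>2)\<close> of the first return time.
\<close>

lemma first_passage:
  assumes t: "0 \<le> t" "t \<le> 1"
  shows "t * ((1 + (first_passage t)\<^sup>2) / 2) = first_passage t"
    and "t * first_passage t = 1 - sqrt (1 - t\<^sup>2)"
    and "0 \<le> first_passage t" "first_passage t \<le> 1"
proof -
  define s where "s = sqrt (1 - t\<^sup>2)"
  have "t\<^sup>2 \<le> 1" using t by (simp add: power_le_one)
  then have s: "0 \<le> s" "t\<^sup>2 = (1 - s) * (1 + s)"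
    by (simp_all add: s_def algebra_simps flip: power2_eq_square)
  have g: "first_passage t = t / (1 + s)" by (simp add: first_passage_def s_def)
  then have "t * first_passage t = 1 - s"
    using s by (simp add: power2_eq_square[symmetric])
  then show eq: "t * first_passage t = 1 - sqrt (1 - t\<^sup>2)" by (simp add: s_def)
  have "(first_passage t)\<^sup>2 = (1 - s) / (1 + s)"
    using s by (simp add: g power_divide) (simp add: power2_eq_square)
  then have half: "(1 + (first_passage t)\<^sup>2) / 2 = 1 / (1 + s)"
    using s by (simp add: field_simps)
  show "t * ((1 + (first_passage t)\<^sup>2) / 2) = first_passage t"
    unfolding half by (simp add: g)
  show "0 \<le> first_passage t" "first_passage t \<le> 1" using s t by (simp_all add: g)
qed

lemma first_passage_mono:
  assumes "0 \<le> t" "t \<le> t'" "t' \<le> 1"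
  shows "first_passage t \<le> first_passage t'"
proof -
  have "t\<^sup>2 \<le> t'\<^sup>2" "t'\<^sup>2 \<le> 1" using assms by (simp_all add: power_mono power_le_one)
  then show ?thesis
    using assms unfolding first_passage_def by (intro frac_le) (auto intro: add_pos_nonneg)
qed

text \<open>
  The chance to come down from a position \<open>h + 1\<close> levels high when the current step has already survived.
\<close>

definition halfway :: "nat \<Rightarrow> real \<Rightarrow> real" where
  "halfway h g = g ^ h * ((1 + g\<^sup>2) / 2)"

text \<open>
  After the factor \<open>x\<close> and the summand \<open>1/2\<close> (addresses 0 and 1) the walk starts. Its first step, away
  from 0 and with its own input and bag call, is at 2 and 3. The loops at 4, 9 and 14 are the phases in which all bag bits
  were 0, all were 1, and both values occurred; in the last one the bag is no longer called. The stack holds the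
  distance of the walk from 0 minus one, so that popping the empty stack signals the return to 0.
\<close>

definition arcsin_machine :: machine where
  "arcsin_machine = [Input 19 1, Flip 2 18, Input 19 3, CallBag 0 4 9,
     Input 19 5, CallBag 0 6 15, Flip 7 8, Pop 0 19 4, Push 0 4,
     Input 19 10, CallBag 0 15 11, Flip 12 13, Pop 0 19 9, Push 0 9,
     Input 19 15, Flip 16 17, Pop 0 18 14, Push 0 14,
     Emit 1 20, Emit 0 20]"

fun arcsin_invariant :: "state \<Rightarrow> bool" where
  "arcsin_invariant (l, h, s, out) \<longleftrightarrow>
     (if l < 20 then out = [] else out = [0] \<or> out = [1]) \<and> (l \<le> 3 \<longrightarrow> h = 0)"

text \<open>
  Here \<open>G\<close>, \<open>Z\<close> and \<open>N\<close> are the chances to descend one level with no condition on the bag bits,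
  with all bits 0, and with all bits 1. The walk is accepted if it returns and its bits are mixed; hence the
  differences.
\<close>

fun arcsin_value :: "real \<Rightarrow> real \<Rightarrow> state \<Rightarrow> real" where
  "arcsin_value x u (l, h, s, out) =
    (let G = first_passage x; Z = first_passage (x * (1 - u)); N = first_passage (x * u);
         start = G - (1 - u) * Z - u * N
     in if l < 20 then
       [x * ((1 + x * start) / 2), (1 + x * start) / 2, x * start, start,
        G ^ Suc h - Z ^ Suc h, halfway h G - (1 - u) * halfway h Z, halfway h G - halfway h Z,
          G ^ h - Z ^ h, G ^ Suc (Suc h) - Z ^ Suc (Suc h),
        G ^ Suc h - N ^ Suc h, halfway h G - u * halfway h N, halfway h G - halfway h N,
          G ^ h - N ^ h, G ^ Suc (Suc h) - N ^ Suc (Suc h),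
        G ^ Suc h, halfway h G, G ^ h, G ^ Suc (Suc h), 1, 0] ! l
     else of_bool (out = [1]))"

text \<open>
  A round has up to one flip and one bag call, so \<open>q\<^sup>2\<close> has to be the cost factor of \<open>tail_factor\<close>.
\<close>

lemma arcsin_certificate:
  fixes x :: real
  assumes x: "0 \<le> x" "x < 1"
  defines "C \<equiv> 5 / (1 - x)" and "q \<equiv> sqrt (1 + (1 - x) / 2)"
  shows "certificate arcsin_machine x arcsin_invariant (arcsin_value x)
           (table [C, 1 + C, C, 1 + C, C, 3 + C, 2 + C, 1 + C, 1 + C, C, 3 + C, 2 + C, 1 + C, 1 + C,
                   C, 2 + C, 1 + C, 1 + C, 1, 1] (\<lambda>_. 0))
           (table [2, 2 * q, 2, 2 * q, 2, 2 * q\<^sup>2, 2 * q, 2, 2, 2, 2 * q\<^sup>2, 2 * q, 2, 2, 2, 2 * q, 2, 2, 1, 1] (\<lambda>_. 1)) q"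
    (is "certificate _ _ _ _ ?R ?w _")
proof -
  have C: "5 + x * C = C" "5 \<le> C" using x by (simp_all add: C_def field_simps)
  have q2: "q\<^sup>2 = 1 + (1 - x) / 2" using x by (simp add: q_def)
  have q1: "1 < q" using x by (simp add: q_def)
  then have "q * 1 \<le> q * q" by (intro mult_left_mono) auto
  then have qq: "q \<le> q\<^sup>2" by (simp add: power2_eq_square)
  have top: "(1 - x) + x * (2 * q\<^sup>2) \<le> 2" using tail_factor[of x] by (simp only: q2)
  have "x * (2 * q) \<le> x * (2 * q\<^sup>2)" using qq x by (intro mult_left_mono) auto
  with top qq q1 have q: "1 < q" "1 \<le> q\<^sup>2" "q \<le> q\<^sup>2" "(1 - x) + x * (2 * q\<^sup>2) \<le> 2" "(1 - x) + x * (2 * q) \<le> 2"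
    by linarith+
  have len: "length arcsin_machine = 20" by (simp add: arcsin_machine_def)
  have pcs: "l = 0 \<or> l = 1 \<or> l = 2 \<or> l = 3 \<or> l = 4 \<or> l = 5 \<or> l = 6 \<or> l = 7 \<or> l = 8 \<or> l = 9 \<or> l = 10
     \<or> l = 11 \<or> l = 12 \<or> l = 13 \<or> l = 14 \<or> l = 15 \<or> l = 16 \<or> l = 17 \<or> l = 18 \<or> l = 19"
    if "l < 20" for l :: nat
    using that by presburger
  show ?thesis
  proof (unfold_locales, unfold len)
    show "uses arcsin_machine \<subseteq> basic_resources" by (simp add: uses_def arcsin_machine_def)
    show "arcsin_invariant (succ_state (arcsin_machine ! l) b (l, h, s, out))"
      if "arcsin_invariant (l, h, s, out)" "l < 20" for l h s out b
      using pcs[OF that(2)] that(1) by (elim disjE) (simp_all add: arcsin_machine_def)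
    show "mean u x (arcsin_machine ! l) (arcsin_value x u) (l, h, s, out) = arcsin_value x u (l, h, s, out)"
      if I: "arcsin_invariant (l, h, s, out)" and l: "l < 20" and u: "0 < u" "u < 1" for u l h s out
    proof -
      define G Z N where "G = first_passage x" and "Z = first_passage (x * (1 - u))" and "N = first_passage (x * u)"
      have t: "0 \<le> x * (1 - u)" "x * (1 - u) \<le> 1" "0 \<le> x * u" "x * u \<le> 1"
        using u x by (auto intro!: mult_le_one)
      have eqs: "x * ((1 + G\<^sup>2) / 2) = G" "x * (1 - u) * ((1 + Z\<^sup>2) / 2) = Z" "x * u * ((1 + N\<^sup>2) / 2) = N"
        unfolding G_def Z_def N_def using x t by (intro first_passage(1); simp)+
      have eqs': "x * halfway h G = G ^ Suc h" "x * ((1 - u) * halfway h Z) = Z ^ Suc h" "x * (u * halfway h N) = N ^ Suc h"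
        using arg_cong[OF eqs(1), of "\<lambda>y. G ^ h * y"] arg_cong[OF eqs(2), of "\<lambda>y. Z ^ h * y"]
          arg_cong[OF eqs(3), of "\<lambda>y. N ^ h * y"]
        by (simp_all only: halfway_def power_Suc2 ac_simps)
      have average: "g ^ h / 2 + g ^ Suc (Suc h) / 2 = halfway h g" for g :: real
        by (simp add: halfway_def power2_eq_square algebra_simps add_divide_distrib)
      have average_diff: "(g ^ h - k ^ h) / 2 + (g ^ Suc (Suc h) - k ^ Suc (Suc h)) / 2 = halfway h g - halfway h k" for g k :: real
        by (simp only: average[symmetric] diff_divide_distrib)
      have pop: "g ^ Suc (h - 1) = g ^ h" if "0 < h" for g :: real using that by simp
      have ring: "(1 - u) * (a - b) + u * a = a - (1 - u) * b" "(1 - u) * a + u * (a - b) = a - u * b"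
          "(1 - u) * (a - b) + u * (a - c) = a - (1 - u) * b - u * c"
          "x * (halfway h G - b) = x * halfway h G - x * b" "a / 2 + 1 / 2 = (1 + a) / 2" for a b c :: real
        by (simp_all add: algebra_simps)
      show ?thesis
        using pcs[OF l] I
        by (elim disjE)
          (simp_all del: power_Suc add: arcsin_machine_def mean_def Let_def G_def[symmetric] Z_def[symmetric] N_def[symmetric]
             pop ring eqs' average average_diff)
    qed
    show "0 \<le> arcsin_value x u (l, h, s, out) \<and> arcsin_value x u (l, h, s, out) \<le> 1"
      if I: "arcsin_invariant (l, h, s, out)" and u: "0 < u" "u < 1" for u l h s out
    proof -
      define G Z N where "G = first_passage x" and "Z = first_passage (x * (1 - u))" and "N = first_passage (x * u)"
      have t: "0 \<le> x * (1 - u)" "x * (1 - u) \<le> x" "0 \<le> x * u" "x * u \<le> x"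
        using u x by (auto intro!: mult_left_le)
      have G: "0 \<le> G" "G \<le> 1" "0 \<le> Z" "Z \<le> G" "0 \<le> N" "N \<le> G"
        unfolding G_def Z_def N_def using x t
        by (auto intro!: first_passage(3,4) first_passage_mono)
      have pw: "0 \<le> G ^ k" "G ^ k \<le> 1" "0 \<le> Z ^ k" "Z ^ k \<le> G ^ k" "0 \<le> N ^ k" "N ^ k \<le> G ^ k" for k
        using G by (auto intro: power_mono power_le_one)
      have "halfway h G \<le> 1"
        unfolding halfway_def by (rule mult_le_one) (use pw[of h] pw[of 2] in auto)
      moreover have "0 \<le> halfway h G" "0 \<le> halfway h Z" "halfway h Z \<le> halfway h G" "0 \<le> halfway h N" "halfway h N \<le> halfway h G"
        unfolding halfway_def using pw[of h] pw[of 2] by (auto intro!: mult_mono)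
      ultimately have hw: "0 \<le> halfway h G" "halfway h G \<le> 1" "0 \<le> halfway h Z" "halfway h Z \<le> halfway h G"
          "0 \<le> halfway h N" "halfway h N \<le> halfway h G" by simp_all
      have parts: "0 \<le> (1 - u) * halfway h Z" "(1 - u) * halfway h Z \<le> halfway h Z" "0 \<le> u * halfway h N" "u * halfway h N \<le> halfway h N"
        using hw u by (auto intro: mult_left_le_one_le)
      have "(1 - u) * Z + u * N \<le> (1 - u) * G + u * G" "0 \<le> (1 - u) * Z" "0 \<le> u * N"
        using G u by (auto intro!: add_mono mult_left_mono)
      then have start: "0 \<le> G - (1 - u) * Z - u * N" "G - (1 - u) * Z - u * N \<le> 1"
        using G by (auto simp: algebra_simps)
      then have xstart: "0 \<le> x * (G - (1 - u) * Z - u * N)" "x * (G - (1 - u) * Z - u * N) \<le> 1"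
        using x by (auto intro: mult_le_one)
      have first: "0 \<le> x * ((1 + x * (G - (1 - u) * Z - u * N)) / 2)"
          "x * ((1 + x * (G - (1 - u) * Z - u * N)) / 2) \<le> 1"
      proof -
        show "0 \<le> x * ((1 + x * (G - (1 - u) * Z - u * N)) / 2)" using x xstart by simp
        show "x * ((1 + x * (G - (1 - u) * Z - u * N)) / 2) \<le> 1"
          by (rule mult_le_one) (use x xstart in auto)
      qed
      have diffs: "0 \<le> G ^ k - Z ^ k" "G ^ k - Z ^ k \<le> 1" "0 \<le> G ^ k - N ^ k" "G ^ k - N ^ k \<le> 1" for k
        using pw[of k] by linarith+
      have hdiffs: "0 \<le> halfway h G - (1 - u) * halfway h Z" "halfway h G - (1 - u) * halfway h Z \<le> 1" "0 \<le> halfway h G - u * halfway h N" "halfway h G - u * halfway h N \<le> 1"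
          "0 \<le> halfway h G - halfway h Z" "halfway h G - halfway h Z \<le> 1" "0 \<le> halfway h G - halfway h N" "halfway h G - halfway h N \<le> 1"
        using hw parts by linarith+
      show ?thesis
      proof (cases "l < 20")
        case True
        show ?thesis
          using pcs[OF True] first start hdiffs
          unfolding arcsin_value.simps Let_def G_def[symmetric] Z_def[symmetric] N_def[symmetric]
          by (elim disjE)
            (simp_all del: power_Suc add: pw diffs hdiffs hw start xstart first divide_le_eq_1 add_nonneg_nonneg)
      qed (simp add: Let_def)
    qed
    show "1 + mean u x (arcsin_machine ! l) ?R (l, h, s, out) \<le> ?R (l, h, s, out)"
      if "arcsin_invariant (l, h, s, out)" "l < 20" "0 < u" "u < 1" for u l h s out
    proof -
      have "(1 - u) * 1 + u * C \<le> (1 - u) * C + u * C"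
        using that C by (intro add_mono mult_left_mono) auto
      then show ?thesis using pcs[OF that(2)] that C x
        by (elim disjE; simp add: arcsin_machine_def mean_def algebra_simps)
    qed
    show "flip_cost q (arcsin_machine ! l) * mean u x (arcsin_machine ! l) ?w (l, h, s, out) \<le> ?w (l, h, s, out)"
      if "arcsin_invariant (l, h, s, out)" "l < 20" "0 \<le> u" "u \<le> 1" for u l h s out
    proof -
      show ?thesis using pcs[OF that(2)] that(1) q x
        by (elim disjE; simp add: arcsin_machine_def mean_def algebra_simps power2_eq_square)
    qed
    fix z :: state
    obtain l h s out where z: "z = (l, h, s, out)" by (cases z)
    have "(\<lambda>u. arcsin_value x u z) \<in> borel_measurable borel \<and> 0 \<le> ?R z \<and> 1 \<le> ?w z"
    proof (cases "l < 20")
      case True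
      have [measurable]: "first_passage \<in> borel_measurable borel"
        unfolding first_passage_def by measurable
      have [measurable]: "halfway h \<in> borel_measurable borel" for h
        unfolding halfway_def by measurable
      show ?thesis using pcs[OF True] C q unfolding z
        by (elim disjE) (simp_all add: Let_def)
    qed (simp add: z Let_def)
    then show "(\<lambda>u. arcsin_value x u z) \<in> borel_measurable borel" "0 \<le> ?R z" "1 \<le> ?w z" by auto
  qed (use x q in \<open>auto simp: len Let_def split: if_splits\<close>)
qed

text \<open>
  With \<open>s t = sqrt (1 - t\<^sup>2)\<close>, the integrand is
  \<open>(x s (x u) + x s (x (1 - u))) / 2 - x s x / 2\<close>. The two variable terms are mirror images and have
  the same integral, whose primitive \<open>A\<close> is the classical one; its boundary term cancels the constant term.
\<close>

lemma arcsin_integral: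
  fixes x :: real
  assumes x: "0 \<le> x" "x < 1"
  shows "((\<lambda>u. arcsin_value x u (0, 0, [], [])) has_integral (1 / 2 * arcsin x)) {0..1}"
proof -
  let ?s = "\<lambda>t::real. sqrt (1 - t\<^sup>2)"
  define A where "A t = (x * t * ?s (x * t) + arcsin (x * t)) / 2" for t
  define F where "F u = (A u - A (1 - u)) / 2 - u * (x * ?s x / 2)" for u
  have A: "(A has_real_derivative x * ?s (x * t)) (at t)" if t: "0 \<le> t" "t \<le> 1" for t
  proof -
    have xt: "0 \<le> x * t" "x * t < 1" using x t mult_left_le[of t x] by auto
    define d where "d = 1 - (x * t)\<^sup>2"
    have d: "0 < d" using xt by (simp add: d_def power_less_one_iff abs_square_less_1)
    define r where "r = sqrt d"
    have r: "0 < r" "r * r = d" "?s (x * t) = r" using d by (simp_all add: r_def d_def)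
    have lin: "((\<lambda>t. x * t) has_real_derivative x) (at t)" by (auto intro!: derivative_eq_intros)
    have D1: "((\<lambda>t. ?s (x * t)) has_real_derivative inverse r / 2 * (- (2 * (x * t) * x))) (at t)"
    proof (rule DERIV_chain2[of sqrt])
      show "(sqrt has_real_derivative inverse r / 2) (at (1 - (x * t)\<^sup>2))"
        using DERIV_real_sqrt[OF d] by (simp add: r_def d_def)
      show "((\<lambda>t. 1 - (x * t)\<^sup>2) has_real_derivative - (2 * (x * t) * x)) (at t)"
        by (auto intro!: derivative_eq_intros)
    qed
    have D2: "((\<lambda>t. arcsin (x * t)) has_real_derivative inverse r * x) (at t)"
    proof (rule DERIV_chain2[of arcsin, OF _ lin])
      show "(arcsin has_real_derivative inverse r) (at (x * t))"
        using DERIV_arcsin[of "x * t"] xt by (simp add: r(3))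
    qed
    have "((\<lambda>t. (x * t * ?s (x * t) + arcsin (x * t)) / 2) has_real_derivative
        (x * ?s (x * t) + inverse r / 2 * (- (2 * (x * t) * x)) * (x * t) + inverse r * x) / 2) (at t)"
      by (intro DERIV_cdivide DERIV_add DERIV_mult lin D1 D2)
    moreover have "(x * r + inverse r / 2 * (- (2 * (x * t) * x)) * (x * t) + inverse r * x) / 2 = x * r"
    proof -
      have "inverse r / 2 * (- (2 * (x * t) * x)) * (x * t) + inverse r * x = x * (inverse r * d)"
        by (simp add: d_def power2_eq_square algebra_simps)
      also have "\<dots> = x * r" using r by (simp flip: r(2))
      finally show ?thesis by simp
    qed
    ultimately show ?thesis unfolding A_def[abs_def] r(3) by (simp only:)
  qed
  have "((\<lambda>u. (x * ?s (x * u) + x * ?s (x * (1 - u))) / 2 - x * ?s x / 2) has_integral (F 1 - F 0)) {0..1}"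
  proof (rule fundamental_theorem_of_calculus)
    fix u :: real assume u: "u \<in> {0..1}"
    have A': "((\<lambda>u. A (1 - u)) has_real_derivative x * ?s (x * (1 - u)) * (- 1)) (at u)"
      by (rule DERIV_chain2[of A]) (use u in \<open>auto intro!: A derivative_eq_intros\<close>)
    have "(F has_real_derivative (x * ?s (x * u) + x * ?s (x * (1 - u))) / 2 - x * ?s x / 2) (at u)"
      unfolding F_def[abs_def] using u by (auto intro!: derivative_eq_intros A A')
    then show "(F has_vector_derivative (x * ?s (x * u) + x * ?s (x * (1 - u))) / 2 - x * ?s x / 2) (at u within {0..1})"
      by (simp add: has_real_derivative_iff_has_vector_derivative has_vector_derivative_at_within)
  qed simp
  also have "F 1 - F 0 = 1 / 2 * arcsin x"
    by (simp add: F_def A_def field_simps)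
  finally have "((\<lambda>u. (x * ?s (x * u) + x * ?s (x * (1 - u))) / 2 - x * ?s x / 2) has_integral (1 / 2 * arcsin x)) {0..1}" .
  then show ?thesis
  proof (rule has_integral_eq[rotated])
    fix u :: real assume u: "u \<in> {0..1}"
    have t: "0 \<le> x * (1 - u)" "x * (1 - u) \<le> 1" "0 \<le> x * u" "x * u \<le> 1"
      using u x by (auto intro!: mult_le_one)
    have "x * (first_passage x - (1 - u) * first_passage (x * (1 - u)) - u * first_passage (x * u))
       = x * first_passage x - (x * (1 - u)) * first_passage (x * (1 - u)) - (x * u) * first_passage (x * u)"
      by (simp add: algebra_simps)
    also have "\<dots> = ?s (x * u) + ?s (x * (1 - u)) - ?s x - 1"
      using t x by (simp add: first_passage(2))
    finally have eq: "x * (first_passage x - (1 - u) * first_passage (x * (1 - u)) - u * first_passage (x * u))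
       = ?s (x * u) + ?s (x * (1 - u)) - ?s x - 1" .
    have "arcsin_value x u (0, 0, [], []) = x * ((1 + (?s (x * u) + ?s (x * (1 - u)) - ?s x - 1)) / 2)"
      unfolding eq[symmetric] by (simp add: Let_def)
    also have "\<dots> = (x * ?s (x * u) + x * ?s (x * (1 - u))) / 2 - x * ?s x / 2"
      by (simp add: field_simps)
    finally show "(x * ?s (x * u) + x * ?s (x * (1 - u))) / 2 - x * ?s x / 2 = arcsin_value x u (0, 0, [], [])" ..
  qed
qed

section \<open>The Gaussian integral\<close>

text \<open>
  The left end of the interval of numbers whose binary expansion starts with the given bits.
\<close>

fun dyadic :: "bool list \<Rightarrow> real" where
  "dyadic [] = 0"
| "dyadic (b # s) = (of_bool b + dyadic s) / 2"

definition cell_width :: "bool list \<Rightarrow> real" where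
  "cell_width s = (1 / 2) ^ length s"

lemma dyadic_snoc: "dyadic (s @ [b]) = dyadic s + of_bool b * cell_width s / 2"
  by (induction s) (simp_all add: cell_width_def add_divide_distrib)

lemma cell_width_snoc: "cell_width (s @ [b]) = cell_width s / 2"
  by (simp add: cell_width_def)

lemma cell_width_pos: "0 < cell_width s"
  by (simp add: cell_width_def)

lemma dyadic_append:
  "dyadic s \<le> dyadic (s @ t) \<and> dyadic (s @ t) + cell_width (s @ t) \<le> dyadic s + cell_width s"
proof (induction t rule: rev_induct)
  case (snoc b t)
  then show ?case using cell_width_pos[of "s @ t"]
    by (cases b) (simp_all add: dyadic_snoc cell_width_snoc flip: append_assoc)
qed simp

lemma dyadic_nonneg: "0 \<le> dyadic s"
  using dyadic_append[of "[]" s] by simp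

text \<open>
  Given that the current number is \<open>v\<close>, an even number of further stages succeed with probability
  \<open>exp (- a v)\<close>. If only a prefix \<open>s\<close> of \<open>v\<close> is known, this has to be averaged over the interval of \<open>s\<close>.
\<close>

definition exp_cell :: "real \<Rightarrow> bool list \<Rightarrow> real" where
  "exp_cell a s = (exp (- a * dyadic s) - exp (- a * (dyadic s + cell_width s))) / (a * cell_width s)"

text \<open>
  The current number \<open>V\<close> has prefix \<open>p @ r\<close> and the fresh number \<open>W\<close> agrees with it on \<open>p\<close>. This is the
  probability that \<open>W < V\<close> and then an even number of further stages succeed: the expectation
  of \<open>exp (- a W)\<close> over \<open>W < V\<close>, with the inner integral evaluated.
\<close>

definition below_cell :: "real \<Rightarrow> bool list \<Rightarrow> bool list \<Rightarrow> real" where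
  "below_cell a p r = (exp (- a * dyadic p) - exp_cell a (p @ r)) / (a * cell_width p)"

lemma exp_cell_bounds:
  assumes a: "0 < a"
  shows "exp_cell a s \<le> exp (- a * dyadic s)" and "exp (- a * (dyadic s + cell_width s)) \<le> exp_cell a s"
proof -
  define h where "h = a * cell_width s"
  have h: "0 < h" using a cell_width_pos by (simp add: h_def)
  have split: "exp (- a * (dyadic s + cell_width s)) = exp (- a * dyadic s) * exp (- h)"
    by (simp add: h_def distrib_left exp_add[symmetric])
  have E: "exp_cell a s = exp (- a * dyadic s) * ((1 - exp (- h)) / h)"
    unfolding exp_cell_def split h_def[symmetric] by (simp add: right_diff_distrib)
  have "1 - exp (- h) \<le> h" using exp_ge_add_one_self[of "- h"] by simp
  then have "(1 - exp (- h)) / h \<le> 1" using h by simp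
  then show "exp_cell a s \<le> exp (- a * dyadic s)"
    unfolding E by (rule mult_left_le) simp
  have "exp (- h) * (1 + h) \<le> exp (- h) * exp h" by (intro mult_left_mono exp_ge_add_one_self) auto
  then have "exp (- h) * h \<le> 1 - exp (- h)" by (simp add: exp_minus algebra_simps)
  then have "exp (- h) \<le> (1 - exp (- h)) / h" using h by (simp add: le_divide_eq)
  then show "exp (- a * (dyadic s + cell_width s)) \<le> exp_cell a s"
    unfolding E split by (intro mult_left_mono) auto
qed

lemma exp_cell_range:
  assumes "0 < a"
  shows "0 \<le> exp_cell a s" "exp_cell a s \<le> 1"
proof -
  show "0 \<le> exp_cell a s"
    using exp_cell_bounds(2)[OF assms, of s] by (meson exp_ge_zero order_trans)
  have "exp (- a * dyadic s) \<le> 1" using assms dyadic_nonneg[of s] by simp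
  then show "exp_cell a s \<le> 1" using exp_cell_bounds(1)[OF assms, of s] by linarith
qed

lemma below_cell_range:
  assumes a: "0 < a"
  shows "0 \<le> below_cell a p r" "below_cell a p r \<le> 1"
proof -
  have pos: "0 < a * cell_width p" using a cell_width_pos by simp
  have "exp (- a * dyadic (p @ r)) \<le> exp (- a * dyadic p)"
    using a dyadic_append[of p r] by simp
  then have "exp_cell a (p @ r) \<le> exp (- a * dyadic p)"
    using exp_cell_bounds(1)[OF a, of "p @ r"] by linarith
  then show "0 \<le> below_cell a p r" using pos by (simp add: below_cell_def)
  have "exp (- a * (dyadic p + cell_width p)) \<le> exp (- a * (dyadic (p @ r) + cell_width (p @ r)))"
    using a dyadic_append[of p r] by simp
  then have lower: "exp (- a * (dyadic p + cell_width p)) \<le> exp_cell a (p @ r)"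
    using exp_cell_bounds(2)[OF a, of "p @ r"] by linarith
  have "exp (- a * dyadic p) - exp (- a * (dyadic p + cell_width p)) = exp_cell a p * (a * cell_width p)"
    using pos by (simp add: exp_cell_def)
  also have "\<dots> \<le> 1 * (a * cell_width p)"
    using exp_cell_range(2)[OF a, of p] pos by (intro mult_right_mono) auto
  finally show "below_cell a p r \<le> 1" using pos lower by (simp add: below_cell_def)
qed

lemma exp_cell_split: "exp_cell a s = (exp_cell a (s @ [False]) + exp_cell a (s @ [True])) / 2"
proof -
  have w: "dyadic s + cell_width s / 2 + cell_width s / 2 = dyadic s + cell_width s" by simp
  show ?thesis
    unfolding exp_cell_def dyadic_snoc cell_width_snoc
    by (simp add: w add_divide_distrib diff_divide_distrib)
qed

text \<open>
  An unknown digit of \<open>V\<close> is a fair coin.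
\<close>

lemma below_cell_Nil: "below_cell a p [] = (below_cell a p [False] + below_cell a p [True]) / 2"
  unfolding below_cell_def append_Nil2
  by (subst exp_cell_split) (simp add: add_divide_distrib diff_divide_distrib)

text \<open>
  One digit of the comparison. If \<open>V\<close> has a 0, then \<open>W\<close> must have a 0 too and the comparison goes on. If
  \<open>V\<close> has a 1, then a 0 in \<open>W\<close> decides it and \<open>p @ [False]\<close> is what is known of the new number, while a 1
  prolongs the comparison.
\<close>

lemma below_cell_Cons:
  "below_cell a p (False # r) = below_cell a (p @ [False]) r / 2"
  "below_cell a p (True # r) = (exp_cell a (p @ [False]) + below_cell a (p @ [True]) r) / 2"
proof -
  show "below_cell a p (False # r) = below_cell a (p @ [False]) r / 2"
  proof -
    have "y / (a * (w / 2)) / 2 = y / (a * w)" for y w :: real by (simp add: field_simps)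
    then show ?thesis
      unfolding below_cell_def dyadic_snoc cell_width_snoc
      by (simp only: append_assoc append.simps of_bool_eq mult_zero_left div_0 add_0_right)
  qed
  show "below_cell a p (True # r) = (exp_cell a (p @ [False]) + below_cell a (p @ [True]) r) / 2"
  proof -
    have "y / (a * (w / 2)) / 2 = y / (a * w)" for y w :: real by (simp add: field_simps)
    moreover have "(A - B) / c + (B - C) / c = (A - C) / c" for A B C c :: real
      by (simp add: diff_divide_distrib)
    ultimately have "((A - B) / (a * (w / 2)) + (B - C) / (a * (w / 2))) / 2 = (A - C) / (a * w)" for A B C w :: real
      by (simp only:)
    then show ?thesis
      unfolding below_cell_def exp_cell_def[of a "p @ [False]"] dyadic_snoc cell_width_snoc
      by (simp only: append_assoc append.simps of_bool_eq mult_zero_left div_0 add_0_right mult_1_left)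
  qed
qed

text \<open>
  A stage succeeds with probability \<open>a\<close> times that of \<open>W < V\<close>, and success exchanges even and odd.
\<close>

lemma exp_cell_stage: "0 < a \<Longrightarrow> exp_cell a s = 1 - a * below_cell a [] s"
  by (simp add: below_cell_def cell_width_def)

lemma exp_stage: "0 < a \<Longrightarrow> exp (- a) = 1 - a * exp_cell a []"
  by (simp add: exp_cell_def cell_width_def)

text \<open>
  The string register has to hold two bit strings, the part of \<open>V\<close> still to be compared and the part already
  compared, on a two-letter alphabet. A bit \<open>b\<close> becomes the pair \<open>True, b\<close>, and a lone \<open>False\<close> in the position
  of a tag separates the two parts.
\<close>

fun encode :: "bool list \<Rightarrow> bool list" where
  "encode [] = []"
| "encode (b # s) = True # b # encode s"

fun decode :: "bool list \<Rightarrow> bool list" where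
  "decode (True # b # s) = b # decode s"
| "decode s = []"

fun after_mark :: "bool list \<Rightarrow> bool list" where
  "after_mark (True # b # s) = after_mark s"
| "after_mark (False # s) = s"
| "after_mark s = []"

lemma encode_snoc: "encode (s @ [b]) = encode s @ [True, b]"
  by (induction s) auto

lemma decode_encode: "decode (encode s) = s" "decode (encode s @ False # t) = s"
    "after_mark (encode s @ False # t) = t"
  by (induction s) auto

text \<open>
  A stage with the current parity, with base address \<open>b\<close>, exit \<open>d\<close> on failure and the block \<open>b'\<close> of the opposite
  parity on success. Offsets 0 to 4 toss the coin of parameter \<open>(x u)\<^sup>2 / 2\<close>. At 5 the next symbol of \<open>V\<close> is
  requested; an empty string means that \<open>V = 1\<close>, against which every fresh number wins. Offsets 6 and 7 read a
  known bit, 12, 14 and 17 put the separator back and draw an unknown one. At 8 and 9 the corresponding bit of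
  \<open>W\<close> is flipped; equal bits are appended behind the separator at 10 and 13, and at 11 the comparison is
  won. Then 16 and 18 delete the rest of \<open>V\<close> with the old separator, and 15 appends a new one.
\<close>

definition exp_block :: "label \<Rightarrow> label \<Rightarrow> label \<Rightarrow> machine" where
  "exp_block b d b' =
    [Input d (b + 1), Input d (b + 2), CallBag 0 d (b + 3), CallBag 0 d (b + 4), Flip d (b + 5),
     Remove Front 0 (b + 15) (b + 12) (b + 6),
     Insert Back 0 True (b + 7), Remove Front 0 d (b + 8) (b + 9),
     Flip (b + 10) d, Flip (b + 11) (b + 13),
     Insert Back 0 False (b + 5), Insert Back 0 False (b + 16),
     Insert Front 0 False (b + 14), Insert Back 0 True (b + 5), Insert Back 0 True (b + 17),
     Insert Back 0 False b', Remove Front 0 d (b + 15) (b + 18), Flip (b + 8) (b + 9),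
     Remove Front 0 d (b + 16) (b + 16)]"

text \<open>
  The even block starts at 3 and exits to output 1, the odd block starts at 22 and exits to output 0.
\<close>

definition gauss_machine :: machine where
  "gauss_machine = [Input 1 3, Emit 0 41, Emit 1 41] @ exp_block 3 2 22 @ exp_block 22 1 3"

text \<open>
  The winning chance at offset 5. At \<open>V = 1\<close> the fresh number is only known to be uniform.
\<close>

definition compare_value :: "real \<Rightarrow> bool list \<Rightarrow> real" where
  "compare_value a s = (if s = [] then exp_cell a [] else below_cell a (decode (after_mark s)) (decode s))"

text \<open>
  The probability that an odd number of stages succeed from now on, counting the current one if it is in progress.
  In the odd block this is the probability of output 1, in the even block that of output 0.
\<close>

fun block_value :: "real \<Rightarrow> real \<Rightarrow> nat \<Rightarrow> bool list \<Rightarrow> real" where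
  "block_value x u k s =
    (let a = (x * u)\<^sup>2 / 2; B = compare_value a in
     [a * B s, x * u\<^sup>2 / 2 * B s, u\<^sup>2 / 2 * B s, u / 2 * B s, B s / 2,
      B s, B (True # s), B (True # butlast s), B (True # False # butlast s), B (True # True # butlast s),
      B (s @ [False]), exp_cell a (decode (after_mark (s @ [False]))),
      B (False # s), B (s @ [True]), B s,
      exp_cell a (decode s), exp_cell a (decode (after_mark s)), B (butlast s),
      exp_cell a (decode (after_mark (True # s)))] ! k)"

text \<open>
  The remaining part of \<open>V\<close>, the separator, and the part already compared.
\<close>

definition scanning :: "bool list \<Rightarrow> bool" where
  "scanning s \<longleftrightarrow> (\<exists>r p. s = encode r @ False # encode p)"

definition block_invariant :: "nat \<Rightarrow> bool list \<Rightarrow> bool" where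
  "block_invariant k s \<longleftrightarrow>
     (if k < 5 then s = [] \<or> (\<exists>r. s = encode r @ [False])
      else if k = 5 then s = [] \<or> scanning s
      else if k = 6 \<or> k = 18 then (\<exists>b t. s = b # t \<and> scanning t)
      else if k = 7 then (\<exists>b t. s = b # t @ [True] \<and> scanning t)
      else if k \<in> {8, 9, 10, 11, 13} then (\<exists>t. s = t @ [True] \<and> scanning t)
      else if k = 12 \<or> k = 15 then (\<exists>p. s = encode p)
      else if k = 14 then (\<exists>p. s = False # encode p)
      else if k = 16 then scanning s
      else if k = 17 then (\<exists>p. s = False # encode p @ [True])
      else False)"

lemma compare_value_scanning:
  "compare_value a (encode r @ False # encode p) = below_cell a p r"
  "compare_value a (True # b # encode r @ False # encode p) = below_cell a p (b # r)"
  "compare_value a (False # encode p) = below_cell a p []"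
  "compare_value a (encode r @ [False]) = below_cell a [] r"
  using decode_encode(2)[of r "[]"] decode_encode(3)[of r "[]"]
  by (simp_all add: compare_value_def decode_encode)

lemmas encode_snoc' = encode_snoc[symmetric]

lemma block_cases:
  fixes k :: nat
  assumes "k < 19"
  obtains "k < 5" | "k = 5" | "k = 6" | "k = 7" | "k = 8" | "k = 9" | "k = 10" | "k = 11" | "k = 12" | "k = 13"
    | "k = 14" | "k = 15" | "k = 16" | "k = 17" | "k = 18"
proof -
  have "k < 5 \<or> k = 5 \<or> k = 6 \<or> k = 7 \<or> k = 8 \<or> k = 9 \<or> k = 10 \<or> k = 11 \<or> k = 12 \<or> k = 13
    \<or> k = 14 \<or> k = 15 \<or> k = 16 \<or> k = 17 \<or> k = 18"
    using assms by presburger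
  then show thesis using that by (elim disjE)
qed

lemma scanning_intros [simp]:
  "scanning (encode r @ False # encode p)"
  "scanning (False # encode p)"
  "scanning (encode r @ [False])"
proof -
  show *: "scanning (encode r @ False # encode p)" for r p by (auto simp: scanning_def)
  show "scanning (False # encode p)" using *[of "[]"] by simp
  show "scanning (encode r @ [False])" using *[of _ "[]"] by simp
qed

lemma scanning_append [simp]: "scanning t \<Longrightarrow> scanning (t @ [True, b])"
  by (auto simp: scanning_def encode_snoc') (metis append.assoc append_Cons)

lemma scanning_cases:
  assumes "scanning s"
  obtains p where "s = False # encode p" | b t where "s = True # b # t" "scanning t"
proof -
  obtain r p where s: "s = encode r @ False # encode p" using assms by (auto simp: scanning_def)
  show thesis
    by (cases r) (use s that in auto)
qed

lemma block_closed:
  assumes k: "k < 19" and s: "block_invariant k s"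
  shows "\<exists>l s'. succ_state (exp_block b d b' ! k) x (b + k, h, s, out) = (l, h, s', out) \<and>
     (l = d \<or> l = b' \<and> block_invariant 0 s' \<or> (\<exists>k'<19. l = b + k' \<and> block_invariant k' s'))"
    (is "\<exists>l s'. ?succ = _ \<and> _")
proof -
  have inner: ?thesis if "?succ = (b + k', h, s', out)" "k' < 19" "block_invariant k' s'" for k' s'
    using that by blast
  have exit: ?thesis if "?succ = (d, h, s', out)" for s'
    using that by blast
  have branch: ?thesis
    if "?succ = (if x then l1 else l0, h, s', out)" "l0 = d \<or> (\<exists>k'<19. l0 = b + k' \<and> block_invariant k' s')"
      "l1 = d \<or> (\<exists>k'<19. l1 = b + k' \<and> block_invariant k' s')" for l0 l1 s'
    using that by (cases x) auto
  note simps = exp_block_def block_invariant_def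
  from k show ?thesis
  proof (cases rule: block_cases)
    case 1
    then have "k = 0 \<or> k = 1 \<or> k = 2 \<or> k = 3 \<or> k = 4" by linarith
    then show ?thesis using s
      by (elim disjE; cases x) (auto simp: simps)
  next
    case 2
    then consider "s = []" | "scanning s" using s by (auto simp: simps)
    then show ?thesis
    proof cases
      case 1
      then show ?thesis using 2 by (intro inner[of 15 "[]"]) (auto simp: simps intro: exI[of _ "[]"])
    next
      case scan: 2
      then show ?thesis
      proof (cases rule: scanning_cases)
        case (1 p)
        then show ?thesis using 2 by (intro inner[of 12 "encode p"]) (auto simp: simps)
      next
        case (2 y t)
        then show ?thesis using \<open>k = 5\<close> by (intro inner[of 6 "y # t"]) (auto simp: simps)
      qed
    qed
  next
    case 3
    then obtain y t where "s = y # t" "scanning t" using s by (auto simp: simps)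
    then show ?thesis using 3 by (intro inner[of 7 "y # t @ [True]"]) (auto simp: simps)
  next
    case 4
    then obtain y t where "s = y # t @ [True]" "scanning t" using s by (auto simp: simps)
    then show ?thesis using 4 by (intro inner[of "if y then 9 else 8" "t @ [True]"]) (auto simp: simps)
  next
    case 5
    then show ?thesis using s by (intro branch[of d "b + 10" s]) (auto simp: simps)
  next
    case 6
    then show ?thesis using s by (intro branch[of "b + 13" "b + 11" s]) (auto simp: simps)
  next
    case 7
    then obtain t where "s = t @ [True]" "scanning t" using s by (auto simp: simps)
    then show ?thesis using 7 by (intro inner[of 5 "t @ [True, False]"]) (auto simp: simps)
  next
    case 8
    then obtain t where "s = t @ [True]" "scanning t" using s by (auto simp: simps)
    then show ?thesis using 8 by (intro inner[of 16 "t @ [True, False]"]) (auto simp: simps)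
  next
    case 9
    then obtain p where "s = encode p" using s by (auto simp: simps)
    then show ?thesis using 9 by (intro inner[of 14 "False # encode p"]) (auto simp: simps)
  next
    case 10
    then obtain t where "s = t @ [True]" "scanning t" using s by (auto simp: simps)
    then show ?thesis using 10 by (intro inner[of 5 "t @ [True, True]"]) (auto simp: simps)
  next
    case 11
    then obtain p where "s = False # encode p" using s by (auto simp: simps)
    then show ?thesis using 11 by (intro inner[of 17 "False # encode p @ [True]"]) (auto simp: simps)
  next
    case 12
    then show ?thesis using s by (auto simp: simps)
  next
    case 13
    then have "scanning s" using s by (auto simp: simps)
    then show ?thesis
    proof (cases rule: scanning_cases)
      case (1 p)
      then show ?thesis using 13 by (intro inner[of 15 "encode p"]) (auto simp: simps)
    next
      case (2 y t)
      then show ?thesis using 13 by (intro inner[of 18 "y # t"]) (auto simp: simps)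
    qed
  next
    case 14
    then obtain p where p: "s = False # encode p @ [True]" using s by (auto simp: simps)
    have "\<exists>t. s = t @ [True] \<and> scanning t" using p by (intro exI[of _ "False # encode p"]) simp
    then show ?thesis using 14 by (intro branch[of "b + 9" "b + 8" s]) (auto simp: simps)
  next
    case 15
    then obtain y t where "s = y # t" "scanning t" using s by (auto simp: simps)
    then show ?thesis using 15 by (intro inner[of 16 t]) (auto simp: simps)
  qed
qed

text \<open>
  Values in a block are \<open>c + m * block_value\<close>, with \<open>c = 0\<close>, \<open>m = 1\<close> in the odd and \<open>c = 1\<close>, \<open>m = -1\<close> in the
  even block. Entering the other block adds a success, which turns the probability for an odd number into
  its complement.
\<close>

lemma block_value_mean:
  fixes c m :: real
  assumes k: "k < 19" and s: "block_invariant k s" and x: "0 < x" and u: "0 < u"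
    and V: "\<And>k' s. k' < 19 \<Longrightarrow> V (b + k', h, s, out) = c + m * block_value x u k' s"
    and exit: "\<And>s. V (d, h, s, out) = c"
    and switch: "\<And>s. V (b', h, s, out) = c + m * (1 - block_value x u 0 s)"
  shows "mean u x (exp_block b d b' ! k) V (b + k, h, s, out) = c + m * block_value x u k s"
proof -
  define a where "a = (x * u)\<^sup>2 / 2"
  have a: "0 < a" using x u by (simp add: a_def)
  have V1: "V (Suc b, h, s, out) = c + m * block_value x u 1 s" for s
    using V[of 1] by simp
  have V2: "V (Suc (Suc b), h, s, out) = c + m * block_value x u 2 s" for s
    using V[of 2] by simp
  note simps = exp_block_def mean_def block_invariant_def Let_def a_def[symmetric] V V1 V2 exit switch butlast_append
    compare_value_scanning encode_snoc' decode_encode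
  from k show ?thesis
  proof (cases rule: block_cases)
    case 1
    then have "k = 0 \<or> k = 1 \<or> k = 2 \<or> k = 3 \<or> k = 4" by linarith
    then show ?thesis
      by (elim disjE) (simp_all add: simps, simp_all add: a_def power2_eq_square algebra_simps add_divide_distrib)
  next
    case 2
    show ?thesis
    proof (cases "s = []")
      case True
      then show ?thesis using 2 by (simp add: simps compare_value_def)
    next
      case False
      then obtain r p where "s = encode r @ False # encode p"
        using 2 s by (auto simp: block_invariant_def scanning_def)
      then show ?thesis using 2 by (cases r) (simp_all add: simps)
    qed
  next
    case 5
    then obtain r p where "s = encode r @ False # encode p @ [True]" using s by (auto simp: block_invariant_def scanning_def)
    then show ?thesis using 5 by (simp add: simps below_cell_Cons algebra_simps add_divide_distrib)
  next
    case 6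
    then obtain r p where "s = encode r @ False # encode p @ [True]" using s by (auto simp: block_invariant_def scanning_def)
    then show ?thesis using 6 by (simp add: simps below_cell_Cons algebra_simps add_divide_distrib)
  next
    case 12
    then obtain p where "s = encode p" using s by (auto simp: block_invariant_def)
    then show ?thesis using 12 by (simp add: simps exp_cell_stage[OF a])
  next
    case 13
    then obtain r p where "s = encode r @ False # encode p" using s by (auto simp: block_invariant_def scanning_def)
    then show ?thesis using 13 by (cases r) (simp_all add: simps)
  next
    case 14
    then obtain p where "s = False # encode p @ [True]" using s by (auto simp: block_invariant_def)
    then show ?thesis using 14 compare_value_scanning(2)[of a _ "[]" p]
      by (simp add: simps below_cell_Nil) (simp add: algebra_simps add_divide_distrib)
  qed (use s in \<open>auto simp: simps scanning_def\<close>)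
qed

lemma compare_value_range:
  assumes "0 < a"
  shows "0 \<le> compare_value a s \<and> compare_value a s \<le> 1"
  using exp_cell_range[OF assms] below_cell_range[OF assms] by (simp add: compare_value_def)

lemma block_value_range:
  assumes k: "k < 19" and x: "0 < x" "x < 1" and u: "0 < u" "u < 1"
  shows "0 \<le> block_value x u k s \<and> block_value x u k s \<le> 1"
proof -
  define a where "a = (x * u)\<^sup>2 / 2"
  have a: "0 < a" using x u by (simp add: a_def)
  have prod: "0 \<le> c * compare_value a s \<and> c * compare_value a s \<le> 1" if "0 \<le> c" "c \<le> 1" for c s
    using that compare_value_range[OF a, of s] by (auto intro: mult_le_one)
  have u2: "u\<^sup>2 \<le> 1" "0 \<le> u\<^sup>2" using u by (auto simp: power_le_one)
  have "(x * u)\<^sup>2 \<le> 1" using x u by (intro power_le_one) (auto intro: mult_le_one)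
  then have coeffs: "a \<le> 1" by (simp add: a_def)
  have "x * u\<^sup>2 \<le> 1" using x u2 by (intro mult_le_one) auto
  then have halves: "x * u\<^sup>2 / 2 \<le> 1" "u\<^sup>2 / 2 \<le> 1" "u / 2 \<le> 1" using u2 u by auto
  have first: "0 \<le> a * compare_value a s \<and> a * compare_value a s \<le> 1"
      "0 \<le> x * u\<^sup>2 / 2 * compare_value a s \<and> x * u\<^sup>2 / 2 * compare_value a s \<le> 1"
      "0 \<le> u\<^sup>2 / 2 * compare_value a s \<and> u\<^sup>2 / 2 * compare_value a s \<le> 1"
      "0 \<le> u / 2 * compare_value a s \<and> u / 2 * compare_value a s \<le> 1"
      "0 \<le> compare_value a s / 2 \<and> compare_value a s / 2 \<le> 1"
    using prod[of a s] prod[of "x * u\<^sup>2 / 2" s] prod[of "u\<^sup>2 / 2" s] prod[of "u / 2" s]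
      compare_value_range[OF a, of s] a coeffs halves x u u2
    by (simp_all only: less_imp_le zero_le_divide_iff zero_le_mult_iff zero_le_power2 zero_le_numeral simp_thms divide_le_eq_1) auto
  from k show ?thesis
  proof (cases rule: block_cases)
    case 1
    then have "k = 0 \<or> k = 1 \<or> k = 2 \<or> k = 3 \<or> k = 4" by linarith
    then show ?thesis using first
      unfolding block_value.simps Let_def a_def[symmetric] by (elim disjE) simp_all
  qed (simp_all add: Let_def a_def[symmetric] compare_value_range[OF a] exp_cell_range[OF a])
qed

lemma block_value_measurable: "k < 19 \<Longrightarrow> (\<lambda>u. block_value x u k s) \<in> borel_measurable borel"
proof -
  assume k: "k < 19"
  have [measurable]: "(\<lambda>u. exp_cell (a u) s) \<in> borel_measurable borel"
      "(\<lambda>u. below_cell (a u) s t) \<in> borel_measurable borel"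
      "(\<lambda>u. compare_value (a u) s) \<in> borel_measurable borel"
    if [measurable]: "a \<in> borel_measurable borel" for a :: "real \<Rightarrow> real" and s t
    unfolding compare_value_def below_cell_def exp_cell_def by measurable
  from k show ?thesis
  proof (cases rule: block_cases)
    case 1
    then have "k = 0 \<or> k = 1 \<or> k = 2 \<or> k = 3 \<or> k = 4" by linarith
    then show ?thesis by (elim disjE) (simp_all add: Let_def)
  qed (simp_all add: Let_def)
qed

text \<open>
  Each deleted symbol takes a step, so the rank is linear in the string length. Half of the stages that
  reach offset 4 are abandoned there, which allows half the slope before that point. The constants solve the
  resulting linear inequalities, with rounding.
\<close>

definition block_rank :: "nat \<Rightarrow> nat \<Rightarrow> real" where
  "block_rank k n = (if k < 5 then 1 else 2) * real n +
     [36, 35, 34, 33, 32, 60, 55, 52, 53, 53, 63, 41, 60, 63, 57, 38, 38, 54, 38] ! k"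

lemma block_rank:
  assumes k: "k < 19" and s: "block_invariant k s" and x: "0 < x" "x < 1" and u: "0 < u" "u < 1"
    and R: "\<And>k' s. k' < 19 \<Longrightarrow> R (b + k', h, s, out) = block_rank k' (length s)"
    and exit: "\<And>s. R (d, h, s, out) = 1"
    and switch: "\<And>s. R (b', h, s, out) = block_rank 0 (length s)"
  shows "1 + mean u x (exp_block b d b' ! k) R (b + k, h, s, out) \<le> block_rank k (length s)"
proof -
  have R1: "R (Suc b, h, s, out) = block_rank 1 (length s)" "R (Suc (Suc b), h, s, out) = block_rank 2 (length s)" for s
    using R[of 1] R[of 2] by simp_all
  have worst: "(1 - p) * 1 + p * y \<le> y" if "1 \<le> y" "p \<le> 1" for y p :: real
    using mult_left_mono[of 1 y "1 - p"] that by (simp add: algebra_simps)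
  have nonempty: "s \<noteq> []" if "k \<in> {6, 7, 16, 18}"
    using s that by (auto simp: block_invariant_def scanning_def)
  have len_tl: "real (length (tl s)) = real (length s) - 1" if "s \<noteq> []"
    using that by (cases s) auto
  note simps = exp_block_def mean_def R R1 exit switch block_rank_def
  from k show ?thesis
  proof (cases rule: block_cases)
    case 1
    then have "k = 0 \<or> k = 1 \<or> k = 2 \<or> k = 3 \<or> k = 4" by linarith
    then show ?thesis
      using worst[of "real (length s) + 35" x] worst[of "real (length s) + 34" x]
        worst[of "real (length s) + 33" u] worst[of "real (length s) + 32" u] x u
      by (elim disjE) (simp_all add: simps add_divide_distrib)
  qed (use nonempty in \<open>auto simp: simps len_tl add_divide_distrib simp del: length_tl\<close>)
qed

text \<open>
  The weights do not depend on the string, because every compared digit ends the scan with probability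
  \<open>1/2\<close>, and they do not depend on \<open>x\<close>, because the flip at offset 4 alone bounds the number of stages by a
  geometric variable. The constants satisfy the weight inequalities with cost factor \<open>101/100\<close>.
\<close>

definition block_weight :: "nat \<Rightarrow> real" where
  "block_weight k = [2, 2, 17/10, 33/20, 8/5, 21/10, 83/40, 83/40, 83/40, 83/40, 21/10, 2, 21/10, 21/10, 21/10, 2, 2, 21/10, 2] ! k"

lemma block_weight:
  assumes k: "k < 19" and s: "block_invariant k s" and x: "0 \<le> x" "x \<le> 1" and u: "0 \<le> u" "u \<le> 1"
    and W: "\<And>k' s. k' < 19 \<Longrightarrow> W (b + k', h, s, out) = block_weight k'"
    and exit: "\<And>s. W (d, h, s, out) = 1"
    and switch: "\<And>s. W (b', h, s, out) = block_weight 0"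
  shows "flip_cost (101/100) (exp_block b d b' ! k) * mean u x (exp_block b d b' ! k) W (b + k, h, s, out) \<le> block_weight k"
proof -
  have W1: "W (Suc b, h, s, out) = block_weight 1" "W (Suc (Suc b), h, s, out) = block_weight 2" for s
    using W[of 1] W[of 2] by simp_all
  note simps = exp_block_def mean_def W W1 exit switch block_weight_def
  from k show ?thesis
  proof (cases rule: block_cases)
    case 1
    then have "k = 0 \<or> k = 1 \<or> k = 2 \<or> k = 3 \<or> k = 4" by linarith
    then show ?thesis using x u by (elim disjE) (simp_all add: simps algebra_simps)
  qed (auto simp: simps)
qed

lemma nth_gauss_machine:
  "gauss_machine ! 0 = Input 1 3" "gauss_machine ! Suc 0 = Emit 0 41" "gauss_machine ! 2 = Emit 1 41"
  "k < 19 \<Longrightarrow> gauss_machine ! (3 + k) = exp_block 3 2 22 ! k"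
  "k < 19 \<Longrightarrow> gauss_machine ! (22 + k) = exp_block 22 1 3 ! k"
proof -
  have len: "length (exp_block b d b') = 19" for b d b' by (simp add: exp_block_def)
  show "gauss_machine ! 0 = Input 1 3" "gauss_machine ! Suc 0 = Emit 0 41" "gauss_machine ! 2 = Emit 1 41"
    by (simp_all add: gauss_machine_def)
  show "gauss_machine ! (3 + k) = exp_block 3 2 22 ! k" if "k < 19"
    using that by (simp add: gauss_machine_def nth_append len)
  show "gauss_machine ! (22 + k) = exp_block 22 1 3 ! k" if "k < 19"
    using that by (simp add: gauss_machine_def nth_append len nth_Cons')
qed

lemma gauss_pc_cases:
  fixes l :: nat
  assumes "l < 41"
  obtains "l = 0" | "l = 1" | "l = 2" | k where "l = 3 + k" "k < 19" | k where "l = 22 + k" "k < 19"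
proof -
  consider "l = 0" | "l = 1" | "l = 2" | "3 \<le> l" "l < 22" | "22 \<le> l" by linarith
  then show thesis
  proof cases
    case 4
    then show thesis using that(4)[of "l - 3"] by simp
  next
    case 5
    then show thesis using that(5)[of "l - 22"] assms by simp
  qed (use that in auto)
qed

fun gauss_invariant :: "real \<Rightarrow> state \<Rightarrow> bool" where
  "gauss_invariant x (l, h, s, out) \<longleftrightarrow>
     (if l < 41 then out = [] else out = [0] \<or> out = [1]) \<and>
     (l = 0 \<longrightarrow> s = []) \<and>
     (3 \<le> l \<and> l < 22 \<longrightarrow> 0 < x \<and> block_invariant (l - 3) s) \<and>
     (22 \<le> l \<and> l < 41 \<longrightarrow> 0 < x \<and> block_invariant (l - 22) s)"

fun gauss_value :: "real \<Rightarrow> real \<Rightarrow> state \<Rightarrow> real" where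
  "gauss_value x u (l, h, s, out) =
     (if l = 0 then x * exp (- ((x * u)\<^sup>2 / 2))
      else if l = 1 then 0 else if l = 2 then 1
      else if l < 22 then 1 + (- 1) * block_value x u (l - 3) s
      else if l < 41 then 0 + 1 * block_value x u (l - 22) s
      else of_bool (out = [1]))"

fun gauss_rank :: "state \<Rightarrow> real" where
  "gauss_rank (l, h, s, out) =
     (if l = 0 then 38 else if l < 3 then 1
      else if l < 22 then block_rank (l - 3) (length s)
      else if l < 41 then block_rank (l - 22) (length s) else 0)"

fun gauss_weight :: "state \<Rightarrow> real" where
  "gauss_weight (l, h, s, out) =
     (if l = 0 then 2 else if l < 3 then 1
      else if l < 22 then block_weight (l - 3)
      else if l < 41 then block_weight (l - 22) else 1)"

lemma gauss_certificate:
  fixes x :: real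
  assumes x: "0 \<le> x" "x < 1"
  shows "certificate gauss_machine x (gauss_invariant x) (gauss_value x) gauss_rank gauss_weight (101/100)"
proof -
  have len: "length gauss_machine = 41" by (simp add: gauss_machine_def exp_block_def)
  have I_block: "block_invariant k s" "0 < x" "out = []"
    if "gauss_invariant x (l, h, s, out)" "l = 3 + k \<or> l = 22 + k" "k < 19" for l h s out k
    using that by auto
  show ?thesis
  proof (unfold_locales, unfold len)
    show "uses gauss_machine \<subseteq> basic_resources"
      by (simp add: uses_def gauss_machine_def exp_block_def)
    show "gauss_invariant x (0, 0, [], [])" by simp
    show "gauss_invariant x (succ_state (gauss_machine ! l) b (l, h, s, out))"
      if I: "gauss_invariant x (l, h, s, out)" and l: "l < 41" and p: "possible x (gauss_machine ! l) b" for l h s out b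
      using l
    proof (cases rule: gauss_pc_cases)
      case 1
      then show ?thesis using I p by (auto simp: nth_gauss_machine possible_def block_invariant_def)
    next
      case (4 k)
      note block = I_block[OF I, of k] 4
      then obtain l' s' where s': "succ_state (exp_block 3 2 22 ! k) b (3 + k, h, s, out) = (l', h, s', out)"
        "l' = 2 \<or> l' = 22 \<and> block_invariant 0 s' \<or> (\<exists>k'<19. l' = 3 + k' \<and> block_invariant k' s')"
        using block_closed[of k s 3 2 22 b h out] by blast
      then show ?thesis using block by (auto simp: nth_gauss_machine)
    next
      case (5 k)
      note block = I_block[OF I, of k] 5
      then obtain l' s' where s': "succ_state (exp_block 22 1 3 ! k) b (22 + k, h, s, out) = (l', h, s', out)"
        "l' = 1 \<or> l' = 3 \<and> block_invariant 0 s' \<or> (\<exists>k'<19. l' = 22 + k' \<and> block_invariant k' s')"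
        using block_closed[of k s 22 1 3 b h out] by blast
      then show ?thesis using block by (auto simp: nth_gauss_machine)
    qed (use I in \<open>auto simp: nth_gauss_machine\<close>)
    show "0 \<le> gauss_value x u (l, h, s, out) \<and> gauss_value x u (l, h, s, out) \<le> 1"
      if I: "gauss_invariant x (l, h, s, out)" and u: "0 < u" "u < 1" for u l h s out
    proof (cases "l < 41")
      case True
      then show ?thesis
      proof (cases rule: gauss_pc_cases)
        case 1
        then show ?thesis using x by (auto intro: mult_le_one)
      next
        case (4 k)
        then show ?thesis using block_value_range[of k x u s] I_block[OF I, of k] x u by simp
      next
        case (5 k)
        then show ?thesis using block_value_range[of k x u s] I_block[OF I, of k] x u by simp
      qed auto
    qed simp
    show "mean u x (gauss_machine ! l) (gauss_value x u) (l, h, s, out) = gauss_value x u (l, h, s, out)"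
      if I: "gauss_invariant x (l, h, s, out)" and l: "l < 41" and u: "0 < u" "u < 1" for u l h s out
      using l
    proof (cases rule: gauss_pc_cases)
      case 1
      show ?thesis
      proof (cases "x = 0")
        case False
        then have "exp (- ((x * u)\<^sup>2 / 2)) = 1 - (x * u)\<^sup>2 / 2 * exp_cell ((x * u)\<^sup>2 / 2) []"
          using x u by (intro exp_stage) simp
        then show ?thesis using 1 I
          by (simp add: nth_gauss_machine mean_def compare_value_def)
      qed (use 1 in \<open>simp add: nth_gauss_machine mean_def\<close>)
    next
      case (4 k)
      note block = I_block[OF I, of k] 4
      show ?thesis unfolding \<open>l = 3 + k\<close> nth_gauss_machine(4)[OF \<open>k < 19\<close>]
        by (subst block_value_mean[where c = 1 and m = "-1"]) (use block u in auto)
    next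
      case (5 k)
      note block = I_block[OF I, of k] 5
      show ?thesis unfolding \<open>l = 22 + k\<close> nth_gauss_machine(5)[OF \<open>k < 19\<close>]
        by (subst block_value_mean[where c = 0 and m = 1]) (use block u in auto)
    qed (use I in \<open>auto simp: nth_gauss_machine mean_def\<close>)
    show "1 + mean u x (gauss_machine ! l) gauss_rank (l, h, s, out) \<le> gauss_rank (l, h, s, out)"
      if I: "gauss_invariant x (l, h, s, out)" and l: "l < 41" and u: "0 < u" "u < 1" for u l h s out
      using l
    proof (cases rule: gauss_pc_cases)
      case 1
      then show ?thesis using I x by (simp add: nth_gauss_machine mean_def block_rank_def)
    next
      case (4 k)
      note block = I_block[OF I, of k] 4
      then have "1 + mean u x (exp_block 3 2 22 ! k) gauss_rank (3 + k, h, s, out) \<le> block_rank k (length s)"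
        using x u by (intro block_rank) auto
      then show ?thesis using 4 by (simp add: nth_gauss_machine)
    next
      case (5 k)
      note block = I_block[OF I, of k] 5
      then have "1 + mean u x (exp_block 22 1 3 ! k) gauss_rank (22 + k, h, s, out) \<le> block_rank k (length s)"
        using x u by (intro block_rank) auto
      then show ?thesis using 5 by (simp add: nth_gauss_machine)
    qed (use I in \<open>auto simp: nth_gauss_machine mean_def\<close>)
    show "flip_cost (101/100) (gauss_machine ! l) * mean u x (gauss_machine ! l) gauss_weight (l, h, s, out)
        \<le> gauss_weight (l, h, s, out)"
      if I: "gauss_invariant x (l, h, s, out)" and l: "l < 41" and u: "0 \<le> u" "u \<le> 1" for u l h s out
      using l
    proof (cases rule: gauss_pc_cases)
      case 1
      then show ?thesis using I x by (simp add: nth_gauss_machine mean_def block_weight_def)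
    next
      case (4 k)
      note block = I_block[OF I, of k] 4
      then have "flip_cost (101/100) (exp_block 3 2 22 ! k) * mean u x (exp_block 3 2 22 ! k) gauss_weight (3 + k, h, s, out)
          \<le> block_weight k"
        using x u by (intro block_weight) auto
      then show ?thesis using 4 by (simp add: nth_gauss_machine)
    next
      case (5 k)
      note block = I_block[OF I, of k] 5
      then have "flip_cost (101/100) (exp_block 22 1 3 ! k) * mean u x (exp_block 22 1 3 ! k) gauss_weight (22 + k, h, s, out)
          \<le> block_weight k"
        using x u by (intro block_weight) auto
      then show ?thesis using 5 by (simp add: nth_gauss_machine)
    qed (use I in \<open>auto simp: nth_gauss_machine mean_def\<close>)
    fix z :: state
    obtain l h s out where z: "z = (l, h, s, out)" by (cases z)
    have rank: "0 \<le> block_rank k n" and weight: "1 \<le> block_weight k" if "k < 19" for k n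
      using that by (cases rule: block_cases; auto simp: block_rank_def block_weight_def less_Suc_eq numeral_eq_Suc)+
    have "(\<lambda>u. gauss_value x u z) \<in> borel_measurable borel \<and> 0 \<le> gauss_rank z \<and> 1 \<le> gauss_weight z"
    proof (cases "l < 41")
      case True
      then show ?thesis
      proof (cases rule: gauss_pc_cases)
        case (4 k)
        then show ?thesis using rank weight block_value_measurable[of k x s] unfolding z by simp
      next
        case (5 k)
        then show ?thesis using rank weight block_value_measurable[of k x s] unfolding z by simp
      qed (simp_all add: z)
    qed (simp add: z)
    then show "(\<lambda>u. gauss_value x u z) \<in> borel_measurable borel" "0 \<le> gauss_rank z" "1 \<le> gauss_weight z" by auto
  qed (use x in \<open>auto simp: len\<close>)
qed

text \<open>
  The substitution \<open>w = x u\<close>.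
\<close>

lemma gauss_integral:
  fixes x :: real
  assumes x: "0 \<le> x" "x < 1"
  shows "((\<lambda>u. gauss_value x u (0, 0, [], [])) has_integral integral {0..x} (\<lambda>w. exp (- w\<^sup>2 / 2))) {0..1}"
proof -
  have "((\<lambda>u. x *\<^sub>R exp (- (x * u)\<^sup>2 / 2)) has_integral integral {x * 0..x * 1} (\<lambda>w. exp (- w\<^sup>2 / 2))) {0..1}"
    using x by (intro has_integral_substitution[where c = 0 and d = x])
      (auto intro!: continuous_intros derivative_eq_intros mult_left_le)
  then show ?thesis by simp
qed

lemma strongly_realizes_log: "strongly_realizes log_machine {0..<1} (\<lambda>x. ln (1 + x))"
proof (rule strongly_realizesI)
  fix x :: real assume x: "0 \<le> x" "x < 1"
  show "\<exists>I v R w q. certificate log_machine x I v R w q \<and>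
      ((\<lambda>u. v u (0, 0, [], [])) has_integral ln (1 + x)) {0..1}"
    by (intro exI conjI, rule log_certificate[OF x]) (use log_integral[OF x] in simp)
qed

lemma strongly_realizes_arctan: "strongly_realizes arctan_machine {0..<1} (\<lambda>x. arctan x)"
proof (rule strongly_realizesI)
  fix x :: real assume x: "0 \<le> x" "x < 1"
  show "\<exists>I v R w q. certificate arctan_machine x I v R w q \<and>
      ((\<lambda>u. v u (0, 0, [], [])) has_integral arctan x) {0..1}"
    by (intro exI conjI, rule arctan_certificate[OF x]) (use arctan_integral[of x] in simp)
qed

lemma strongly_realizes_arcsin: "strongly_realizes arcsin_machine {0..<1} (\<lambda>x. 1 / 2 * arcsin x)"
proof (rule strongly_realizesI)
  fix x :: real assume x: "0 \<le> x" "x < 1"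
  show "\<exists>I v R w q. certificate arcsin_machine x I v R w q \<and>
      ((\<lambda>u. v u (0, 0, [], [])) has_integral 1 / 2 * arcsin x) {0..1}"
    by (intro exI conjI, rule arcsin_certificate[OF x], rule arcsin_integral[OF x])
qed

lemma strongly_realizes_gauss:
  "strongly_realizes gauss_machine {0..<1} (\<lambda>x. integral {0..x} (\<lambda>w. exp (- w\<^sup>2 / 2)))"
proof (rule strongly_realizesI)
  fix x :: real assume x: "0 \<le> x" "x < 1"
  show "\<exists>I v R w q. certificate gauss_machine x I v R w q \<and>
      ((\<lambda>u. v u (0, 0, [], [])) has_integral integral {0..x} (\<lambda>w. exp (- w\<^sup>2 / 2))) {0..1}"
    by (intro exI conjI, rule gauss_certificate[OF x], rule gauss_integral[OF x])
qed

theorem theorem4p2: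
  shows "(strongly_realizable {0..<1} (\<lambda>x. ln (1 + x)) \<and>
          strongly_realizable {0..<1} (\<lambda>x. arctan x) \<and>
          strongly_realizable {0..<1} (\<lambda>x. 1 / 2 * arcsin x) \<and>
          strongly_realizable {0..<1} (\<lambda>x. integral {0..x} (\<lambda>w. exp (- w\<^sup>2 / 2)))) \<and>
         strongly_realizable_with {Bag 0} {0..<1} (\<lambda>x. ln (1 + x)) \<and>
         strongly_realizable_with {Bag 0} {0..<1} (\<lambda>x. arctan x) \<and>
         strongly_realizable_with {Bag 0, Stack 0} {0..<1} (\<lambda>x. 1 / 2 * arcsin x) \<and>
         strongly_realizable_with {StringRegister 0, Bag 0} {0..<1}
           (\<lambda>x. integral {0..x} (\<lambda>w. exp (- w\<^sup>2 / 2)))"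
proof -
  have "uses log_machine \<subseteq> {Bag 0}" "uses arctan_machine \<subseteq> {Bag 0}" "uses arcsin_machine \<subseteq> {Bag 0, Stack 0}"
    "uses gauss_machine \<subseteq> {StringRegister 0, Bag 0}"
    by (simp_all add: uses_def log_machine_def arctan_machine_def arcsin_machine_def gauss_machine_def exp_block_def)
  then show ?thesis
    unfolding strongly_realizable_def strongly_realizable_with_def
    using strongly_realizes_log strongly_realizes_arctan strongly_realizes_arcsin strongly_realizes_gauss
    by blast
qed

end
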